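(* Let $J$ be the monic Jacobi matrix associated with a nonrational function $F\in\mathbf N_{-\infty}$, and let $J=LU$ be its block $LU$-factorization. Then the matrix $\mathfrak J=UL$ is the monic generalized Jacobi matrix associated with the function $\lambda F(\lambda)+s_0\in\mathbf D^-_{-\infty}$.
   Context: $\lambda\widehat\to\infty$ means that $\lambda\to\infty$ inside a sector $\varepsilon<\arg\lambda<\pi-\varepsilon$, $\varepsilon>0$. $\mathbf N$ is the class of Nevanlinna functions (analytic in $\mathbb C_+$, mapping $\mathbb C_+$ into $\mathbb C_+$). $\mathbf N_{-\infty}$ is the set of $F\in\mathbf N$ for which there are real $s_0,s_1,\dots$ with $F(\lambda)=-\frac{s_0}{\lambda}-\dots-\frac{s_{2n}}{\lambda^{2n+1}}+o(\lambda^{-2n-1})$, $\lambda\widehat\to\infty$, for every $n\in\mathbb Z_+$ (written $F(\lambda)\sim-\sum_j s_j\lambda^{-j-1}$); equivalently $F(\lambda)=\int_{\mathbb R}\frac{d\sigma(t)}{t-\lambda}$ with a finite measure $\sigma$ with moments $s_j=\int t^jd\sigma(t)$. Let $P_j$ be the monic orthogonal polynomials of $\sigma/s_0$: $\lambda P_j=P_{j+1}+b_jP_j+c_{j-1}P_{j-1}$, $P_{-1}=0$, $P_0=1$, $b_j\in\mathbb R$, $c_j>0$. The monic Jacobi matrix $J$ associated with $F$ is the semi-infinite tridiagonal matrix with $J_{j,j}=b_j$, $J_{j,j+1}=1$, $J_{j+1,j}=c_j$. $\mathbf D^-_{-\infty}$: functions $\mathfrak F$ meromorphic in $\mathbb C_+$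 such that for some $\mathfrak s_{-1}\in\mathbb R\setminus\{0\}$ one has $-\frac{\mathfrak s_{-1}}{\lambda}+\frac{\mathfrak F(\lambda)}{\lambda}\in\mathbf N_{-\infty}$. $\mathbf D^+_{-\infty}$: functions $\mathfrak F$ meromorphic in $\mathbb C_+$ with $\mathfrak F(\lambda)\sim-\sum_{j\ge0}\mathfrak s_j\lambda^{-j-1}$, $\mathfrak s_j\in\mathbb R$, and $\lambda\mathfrak F(\lambda)+\mathfrak s_0\in\mathbf N_{-\infty}$. Normal indices of a real sequence $\{\mathfrak s_j\}_{j\ge0}$: the integers $n\ge1$ with $\det(\mathfrak s_{i+k})_{i,k=0}^{n-1}\neq0$, listed increasingly $\mathfrak n_1<\mathfrak n_2<\cdots$; $\mathfrak n_0=0$, $\mathfrak k_j=\mathfrak n_{j+1}-\mathfrak n_j$ (always $\mathfrak k_j\in\{1,2\}$ here). Generalized Jacobi matrix: let $\mathfrak F\in\mathbf D^\pm_{-\infty}$ be nonrational with $\mathfrak F\sim-\sum\mathfrak s_j\lambda^{-j-1}$. It is normalized if its first nonzero coefficient $\mathfrak s_{\mathfrak n_1-1}$ has modulus $1$. For normalized $\mathfrak F$ put $\mathfrak F_0=\mathfrak F$ and define recursively $-1/\mathfrak F_j(\lambda)=\epsilon_j\mathfrak p_j(\lambda)+\mathfrak b_j^2\mathfrak F_{j+1}(\lambda)$, where $\epsilon_j=\pm1$ is the first nonzero asymptotic coefficient of $\mathfrak F_j$, $\mathfrak p_j$ is the monic polynomial (of degree $\mathfrak k_j$) for which $-1/\mathfrak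 F_j-\epsilon_j\mathfrak p_j=o(1)$ as $\lambda\widehat\to\infty$, and $\mathfrak b_j>0$ is such that $\mathfrak F_{j+1}$ is normalized. Put $\mathfrak c_j=\epsilon_j\epsilon_{j+1}\mathfrak b_j^2$; write $\mathfrak p_j(\lambda)=\lambda+\mathfrak p_0^{(j)}$ if $\mathfrak k_j=1$ and $\mathfrak p_j(\lambda)=\lambda^2+\mathfrak p_1^{(j)}\lambda+\mathfrak p_0^{(j)}$ if $\mathfrak k_j=2$. The monic generalized Jacobi matrix associated with $\mathfrak F$ is the block tridiagonal matrix with diagonal blocks $\mathfrak B_j=-\mathfrak p_0^{(j)}$ if $\mathfrak k_j=1$, $\mathfrak B_j=\begin{pmatrix}0&1\\-\mathfrak p_0^{(j)}&-\mathfrak p_1^{(j)}\end{pmatrix}$ if $\mathfrak k_j=2$, superdiagonal blocks $\mathfrak D_j$ ($\mathfrak k_j\times\mathfrak k_{j+1}$, lower-left entry $1$, other entries $0$) and subdiagonal blocks $\mathfrak C_j$ ($\mathfrak k_{j+1}\times\mathfrak k_j$, lower-left entry $\mathfrak c_j$, other entries $0$). If $\mathfrak F$ is not normalized, the matrix associated with $\mathfrak F$ is by definition the one associated with $\mathfrak F/|\mathfrak s_{\mathfrak n_1-1}|$. Block $LU$-factorization of $J$: let $\{\mathfrak n_j\}_{j\ge1}$ be the normal indices of $\{s_{j+1}\}_{j\ge0}$, $\mathfrak n_0=0$, and $\mathfrak k_j=\mathfrak n_{j+1}-\mathfrak n_j$, $j\in\mathbb Z_+$. Then $J=LU$ for unique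 block matrices of the following form: $L$ has identity diagonal blocks $I_{\mathfrak k_j}$, subdiagonal blocks $L_{j+1}$ ($\mathfrak k_{j+1}\times\mathfrak k_j$, upper-left entry $l_{j+1}$, other entries $0$), and zeros elsewhere; $U$ has diagonal blocks $U_j=u_0^{(j)}$ if $\mathfrak k_j=1$, $U_j=\begin{pmatrix}0&1\\ u_0^{(j)}&u_1^{(j)}\end{pmatrix}$ if $\mathfrak k_j=2$, superdiagonal blocks $D_j$ ($\mathfrak k_j\times\mathfrak k_{j+1}$, lower-left entry $1$, other entries $0$), and zeros elsewhere. *)

theory Defs
  imports
    "HOL-Complex_Analysis.Complex_Analysis"
    "HOL-Library.Landau_Symbols"
    "Jordan_Normal_Form.Determinant"
begin

section \<open>Functions on the upper half plane\<close>

definition uhp :: "complex set" where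
  "uhp = {z. Im z > 0}"

definition sector_infinity :: "real \<Rightarrow> complex filter" where
  "sector_infinity e = inf at_infinity (principal {z. e < Arg z \<and> Arg z < pi - e})"

text \<open>\<open>F(z) \<sim> - (\<Sum>j. s\<^sub>j / z\<^bsup>j+1\<^esup>)\<close> as \<open>z\<close> tends to infinity non-tangentially.\<close>

definition has_expansion :: "(complex \<Rightarrow> complex) \<Rightarrow> (nat \<Rightarrow> real) \<Rightarrow> bool" where
  "has_expansion F s \<longleftrightarrow>
     (\<forall>e>0. \<forall>n. (\<lambda>z. F z - (\<Sum>j\<le>2*n. - of_real (s j) / z ^ (j + 1)))
        \<in> o[sector_infinity e](\<lambda>z. 1 / z ^ (2*n + 1)))"

definition nevanlinna :: "(complex \<Rightarrow> complex) set" where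
  "nevanlinna = {F. F holomorphic_on uhp \<and> (\<forall>z\<in>uhp. F z \<in> uhp)}"

definition N_minf :: "(complex \<Rightarrow> complex) set" where
  "N_minf = {F \<in> nevanlinna. \<exists>s. has_expansion F s}"

definition D_minus :: "(complex \<Rightarrow> complex) set" where
  "D_minus = {F. F meromorphic_on uhp \<and>
     (\<exists>c::real. c \<noteq> 0 \<and> (\<lambda>z. - of_real c / z + F z / z) \<in> N_minf)}"

definition D_plus :: "(complex \<Rightarrow> complex) set" where
  "D_plus = {F. F meromorphic_on uhp \<and>
     (\<exists>s. has_expansion F s \<and> (\<lambda>z. z * F z + of_real (s 0)) \<in> N_minf)}"

text \<open>Identities between meromorphic functions are required off a set without accumulation point
  in the upper half plane, since the values of a \<^const>\<open>meromorphic_on\<close> function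
  at its poles (and of its reciprocal at its zeros) carry no information.\<close>

definition rational_on_uhp :: "(complex \<Rightarrow> complex) \<Rightarrow> bool" where
  "rational_on_uhp F \<longleftrightarrow>
     (\<exists>p q :: complex poly. q \<noteq> 0 \<and> eventually (\<lambda>z. F z = poly p z / poly q z) (cosparse uhp))"


section \<open>Infinite block matrices\<close>

type_synonym inf_mat = "nat \<Rightarrow> nat \<Rightarrow> real"

text \<open>Only used for banded matrices, for which the series below are finite sums.\<close>

definition inf_mat_mult :: "inf_mat \<Rightarrow> inf_mat \<Rightarrow> inf_mat" where
  "inf_mat_mult A B = (\<lambda>r c. \<Sum>k. A r k * B k c)"

text \<open>For \<open>n 0 = 0 < n 1 < n 2 < \<dots>\<close>, the \<open>i\<close>-th block row (column) consists of the rows (columns)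
  with index in \<open>{n i ..< n (i + 1)}\<close>.\<close>

definition gap :: "(nat \<Rightarrow> nat) \<Rightarrow> nat \<Rightarrow> nat" where
  "gap n j = n (Suc j) - n j"

definition block_of :: "(nat \<Rightarrow> nat) \<Rightarrow> nat \<Rightarrow> nat" where
  "block_of n r = (LEAST i. r < n (Suc i))"

definition block_matrix :: "(nat \<Rightarrow> nat) \<Rightarrow> (nat \<Rightarrow> nat \<Rightarrow> real Matrix.mat) \<Rightarrow> inf_mat" where
  "block_matrix n B = (\<lambda>r c. B (block_of n r) (block_of n c)
     $$ (r - n (block_of n r), c - n (block_of n c)))"

definition block_tridiagonal ::
  "(nat \<Rightarrow> nat) \<Rightarrow> (nat \<Rightarrow> real Matrix.mat) \<Rightarrow> (nat \<Rightarrow> real Matrix.mat) \<Rightarrow> (nat \<Rightarrow> real Matrix.mat)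
    \<Rightarrow> inf_mat" where
  "block_tridiagonal n diag super sub = block_matrix n (\<lambda>i k.
     if k = i then diag i
     else if k = Suc i then super i
     else if i = Suc k then sub k
     else 0\<^sub>m (gap n i) (gap n k))"

definition lower_left :: "nat \<Rightarrow> nat \<Rightarrow> real \<Rightarrow> real Matrix.mat" where
  "lower_left m k x = Matrix.mat m k (\<lambda>(r, c). if r = m - 1 \<and> c = 0 then x else 0)"

definition upper_left :: "nat \<Rightarrow> nat \<Rightarrow> real \<Rightarrow> real Matrix.mat" where
  "upper_left m k x = Matrix.mat m k (\<lambda>(r, c). if r = 0 \<and> c = 0 then x else 0)"


section \<open>Normal indices\<close>

definition hankel_det :: "(nat \<Rightarrow> real) \<Rightarrow> nat \<Rightarrow> real" where
  "hankel_det s n = Determinant.det (Matrix.mat n n (\<lambda>(i, k). s (i + k)))"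

definition normal_indices :: "(nat \<Rightarrow> real) \<Rightarrow> nat set" where
  "normal_indices s = {n. n \<ge> 1 \<and> hankel_det s n \<noteq> 0}"

text \<open>Meaningful when there are infinitely many normal indices.\<close>

definition normal_index :: "(nat \<Rightarrow> real) \<Rightarrow> nat \<Rightarrow> nat" where
  "normal_index s = enumerate (insert 0 (normal_indices s))"

definition first_coeff :: "(nat \<Rightarrow> real) \<Rightarrow> real" where
  "first_coeff s = s (LEAST j. s j \<noteq> 0)"


section \<open>The monic Jacobi matrix of a function in \<^const>\<open>N_minf\<close>\<close>

definition represents :: "real measure \<Rightarrow> (nat \<Rightarrow> real) \<Rightarrow> (complex \<Rightarrow> complex) \<Rightarrow> bool" where
  "represents \<sigma> s F \<longleftrightarrow>
     finite_measure \<sigma> \<and> sets \<sigma> = sets borel \<and>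
     (\<forall>j. integrable \<sigma> (\<lambda>t. t ^ j) \<and> s j = (LINT t|\<sigma>. t ^ j)) \<and>
     (\<forall>z\<in>uhp. F z = (LINT t|\<sigma>. 1 / (complex_of_real t - z)))"

text \<open>Rescaling \<open>\<sigma>\<close> to a probability measure does not change its monic orthogonal polynomials.\<close>

definition monic_orthogonal :: "real measure \<Rightarrow> (nat \<Rightarrow> real poly) \<Rightarrow> bool" where
  "monic_orthogonal \<sigma> P \<longleftrightarrow>
     (\<forall>j. degree (P j) = j \<and> lead_coeff (P j) = 1) \<and>
     (\<forall>i j. i \<noteq> j \<longrightarrow> (LINT t|\<sigma>. poly (P i) t * poly (P j) t) = 0)"

definition monic_jacobi_matrix :: "(nat \<Rightarrow> real) \<Rightarrow> (nat \<Rightarrow> real) \<Rightarrow> inf_mat" where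
  "monic_jacobi_matrix b c = (\<lambda>i k.
     if k = i then b i else if k = Suc i then 1 else if i = Suc k then c k else 0)"

definition is_monic_jacobi_of :: "(complex \<Rightarrow> complex) \<Rightarrow> inf_mat \<Rightarrow> bool" where
  "is_monic_jacobi_of F J \<longleftrightarrow>
     (\<exists>s \<sigma> P b c. has_expansion F s \<and> represents \<sigma> s F \<and> monic_orthogonal \<sigma> P \<and>
        (\<forall>j. c j > 0) \<and>
        (\<forall>j. [:0, 1:] * P j = P (Suc j) + Polynomial.smult (b j) (P j) +
               (if j = 0 then 0 else Polynomial.smult (c (j - 1)) (P (j - 1)))) \<and>
        J = monic_jacobi_matrix b c)"


section \<open>Monic generalized Jacobi matrices\<close>

definition companion_block :: "nat \<Rightarrow> real poly \<Rightarrow> real Matrix.mat" where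
  "companion_block k p =
     (if k = 1 then mat_of_rows_list 1 [[- coeff p 0]]
      else mat_of_rows_list 2 [[0, 1], [- coeff p 0, - coeff p 1]])"

text \<open>The case of normalized \<open>F\<close>: \<open>G\<close> is the sequence of functions generated by the recursion
  \<open>- 1 / G\<^sub>j = \<epsilon>\<^sub>j p\<^sub>j + b\<^sub>j\<^sup>2 G\<^sub>j\<^sub>+\<^sub>1\<close>, and \<open>s j\<close> is the sequence of asymptotic coefficients of \<open>G j\<close>.
  In particular the block sizes are determined by \<open>s 0\<close>.\<close>

definition is_monic_gjm_normalized :: "(complex \<Rightarrow> complex) \<Rightarrow> inf_mat \<Rightarrow> bool" where
  "is_monic_gjm_normalized F M \<longleftrightarrow>
     (\<exists>(G :: nat \<Rightarrow> complex \<Rightarrow> complex) (s :: nat \<Rightarrow> nat \<Rightarrow> real) (\<epsilon> :: nat \<Rightarrow> real)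
        (p :: nat \<Rightarrow> real poly) (b :: nat \<Rightarrow> real).
        let n = normal_index (s 0); k = gap n in
        G 0 = F \<and>
        (\<forall>j. G j meromorphic_on uhp \<and> has_expansion (G j) (s j) \<and>
           \<epsilon> j = first_coeff (s j) \<and> \<bar>\<epsilon> j\<bar> = 1 \<and>
           k j \<in> {1, 2} \<and> degree (p j) = k j \<and> lead_coeff (p j) = 1 \<and>
           (\<forall>e>0. (\<lambda>z. - 1 / G j z - of_real (\<epsilon> j) * poly (map_poly of_real (p j)) z)
              \<in> o[sector_infinity e](\<lambda>_. 1)) \<and>
           b j > 0 \<and>
           eventually (\<lambda>z. - 1 / G j z =
             of_real (\<epsilon> j) * poly (map_poly of_real (p j)) z + of_real ((b j)\<^sup>2) * G (Suc j) z)
             (cosparse uhp)) \<and>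
        M = block_tridiagonal n
              (\<lambda>j. companion_block (k j) (p j))
              (\<lambda>j. lower_left (k j) (k (Suc j)) 1)
              (\<lambda>j. lower_left (k (Suc j)) (k j) (\<epsilon> j * \<epsilon> (Suc j) * (b j)\<^sup>2)))"

text \<open>A normalized function is unaffected by the division below.\<close>

definition is_monic_gjm_of :: "(complex \<Rightarrow> complex) \<Rightarrow> inf_mat \<Rightarrow> bool" where
  "is_monic_gjm_of F M \<longleftrightarrow>
     F \<in> D_minus \<union> D_plus \<and> \<not> rational_on_uhp F \<and>
     (\<exists>s. has_expansion F s \<and> is_monic_gjm_normalized (\<lambda>z. F z / of_real \<bar>first_coeff s\<bar>) M)"


section \<open>Block LU-factorization of a Jacobi matrix\<close>

text \<open>\<open>s\<close> is the coefficient sequence of the function with which \<open>J\<close> is associated; the block sizes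
  come from the normal indices of the shifted sequence.
  The block \<open>L\<^sub>j\<^sub>+\<^sub>1\<close> has entry \<open>l (Suc j)\<close>, so \<open>l 0\<close> is not used.\<close>

definition is_block_LU :: "(nat \<Rightarrow> real) \<Rightarrow> inf_mat \<Rightarrow> inf_mat \<Rightarrow> inf_mat \<Rightarrow> bool" where
  "is_block_LU s J L U \<longleftrightarrow>
     (\<exists>l u0 u1 :: nat \<Rightarrow> real.
        let n = normal_index (\<lambda>j. s (Suc j)); k = gap n in
        L = block_tridiagonal n
              (\<lambda>j. 1\<^sub>m (k j))
              (\<lambda>j. 0\<^sub>m (k j) (k (Suc j)))
              (\<lambda>j. upper_left (k (Suc j)) (k j) (l (Suc j))) \<and>
        U = block_tridiagonal n
              (\<lambda>j. if k j = 1 then mat_of_rows_list 1 [[u0 j]]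
                   else mat_of_rows_list 2 [[0, 1], [u0 j, u1 j]])
              (\<lambda>j. lower_left (k j) (k (Suc j)) 1)
              (\<lambda>j. 0\<^sub>m (k (Suc j)) (k j)) \<and>
        J = inf_mat_mult L U)"

end

theory Submission
  imports Defs
begin

text \<open>
  The statement is a Darboux (Christoffel) transformation, seen through the functions of the second
  kind. Let \<open>P\<^sub>m\<close> be the monic orthogonal polynomials and
  \<open>Q\<^sub>m(z) = \<integral> P\<^sub>m(t) / (t - z) d\<sigma>(t)\<close>, so that \<open>Q\<^sub>0 = F\<close>. As a column vector, \<open>Q\<close> satisfies
  \<open>J Q = z Q + s\<^sub>0 e\<^sub>0\<close>. Put \<open>R = U Q\<close>. Then \<open>L R = z Q + s\<^sub>0 e\<^sub>0\<close>, and hence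
  \<open>(U L) R = z R + s\<^sub>0 U e\<^sub>0\<close>; moreover the first entry of \<open>R\<close> is \<open>z F + s\<^sub>0\<close>. Let \<open>r\<^sub>j\<close> be the first
  entry of the \<open>j\<close>-th block of \<open>R\<close>. A row block of \<open>U L\<close> has companion form, and eliminating the
  second entries of the blocks of size 2 leaves the three-term relation
  \<open>p\<^sub>j r\<^sub>j = r\<^sub>j\<^sub>+\<^sub>1 + c\<^sub>j\<^sub>-\<^sub>1 r\<^sub>j\<^sub>-\<^sub>1\<close> (lemma \<open>three_term\<close>), where
  \<open>c\<^sub>-\<^sub>1 r\<^sub>-\<^sub>1\<close> stands for the constant \<open>- s\<^sub>0 u\<^sub>0\<^bsup>(0)\<^esup>\<close>. Divided by \<open>r\<^sub>j\<close>, this is the recursion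
  \<open>- 1 / G\<^sub>j = \<epsilon>\<^sub>j p\<^sub>j + b\<^sub>j\<^sup>2 G\<^sub>j\<^sub>+\<^sub>1\<close> for suitable multiples \<open>G\<^sub>j\<close> of \<open>r\<^sub>j / r\<^sub>j\<^sub>-\<^sub>1\<close>
  (lemma \<open>tail_recursion\<close>), so the generalized Jacobi matrix of \<open>z F + s\<^sub>0\<close> can be read off \<open>U L\<close>.

  Three things remain to be supplied.

  Normalization and non-vanishing. Since \<open>Q\<^sub>m\<close> behaves like \<open>- h\<^sub>m / z\<^bsup>m+1\<^esup>\<close> with
  \<open>h\<^sub>m = \<integral> P\<^sub>m\<^sup>2 d\<sigma> > 0\<close>, the leading coefficient of \<open>r\<^sub>j\<close> is \<open>- u\<^sub>0\<^bsup>(j)\<^esup> h\<^bsub>n j\<^esub>\<close>. Comparing entries in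
  \<open>J = L U\<close> gives \<open>h\<^bsub>n (j+1)\<^esub> = l\<^sub>j\<^sub>+\<^sub>1 u\<^sub>0\<^bsup>(j)\<^esup> h\<^bsub>n j\<^esub>\<close> (lemma \<open>sq_norm_n_Suc\<close>). This one identity shows that
  all the numbers \<open>l\<^sub>j\<^sub>+\<^sub>1\<close> and \<open>u\<^sub>0\<^bsup>(j)\<^esup>\<close> are nonzero, and that the leading coefficients of the \<open>G\<^sub>j\<close>
  are signs.

  Full asymptotic expansions. Expansions at infinity are encoded as real formal power series in
  \<open>1 / z\<close>. They are unique, compatible with sums, products and quotients, and the expansion of \<open>Q\<^sub>m\<close>
  follows from its three-term recurrence alone, because orthogonality cancels the polynomial part.

  Block sizes. The Hankel determinant of order \<open>n\<close> of the shifted moments vanishes exactly when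
  \<open>P\<^sub>n(0) = 0\<close> (lemma \<open>hankel_det_shifted_eq_0_iff\<close>). Consecutive orthogonal polynomials have no
  common zero, so there are infinitely many normal indices and all gaps are 1 or 2.
\<close>

section \<open>Asymptotic series in sectors\<close>

lemma sector_infinity_le_at_infinity: "sector_infinity e \<le> at_infinity"
  by (simp add: sector_infinity_def)

lemma eventually_uhp_sector_infinity:
  assumes "e > 0"
  shows "eventually (\<lambda>z. z \<in> uhp) (sector_infinity e)"
proof -
  have "z \<in> uhp" if "e < Arg z" "Arg z < pi - e" for z
    using that assms Arg_lt_pi[of z] by (simp add: uhp_def)
  thus ?thesis
    unfolding sector_infinity_def eventually_inf_principal by (auto intro: always_eventually)
qed

lemma eventually_nonzero_sector_infinity: "eventually (\<lambda>z. z \<noteq> 0) (sector_infinity e)"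
  using eventually_not_equal_at_infinity[of 0] sector_infinity_le_at_infinity filter_leD by blast

text \<open>
  For \<open>e \<ge> \<pi> / 2\<close> the sector is empty and every asymptotic statement holds vacuously. Uniqueness of
  expansions therefore needs one sector that contains points near infinity; here it is the one that
  contains the imaginary axis, and the angle 1 works because \<open>1 < \<pi> / 2\<close>.
\<close>

lemma sector_infinity_1_nontrivial: "sector_infinity 1 \<noteq> bot"
proof -
  have "filterlim (\<lambda>x. \<i> * of_real x) at_infinity (at_top :: real filter)"
    by (rule filterlim_norm_at_top_imp_at_infinity) (simp add: norm_mult filterlim_abs_real)
  moreover have "eventually (\<lambda>x::real. \<i> * of_real x \<in> {z. 1 < Arg z \<and> Arg z < pi - 1}) at_top"
  proof (rule eventually_mono[OF eventually_gt_at_top[of 0]])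
    fix x :: real assume "x > 0"
    hence "Arg (\<i> * of_real x) = pi / 2"
      using Arg_times_of_real[of x \<i>] by (simp add: mult.commute)
    thus "\<i> * of_real x \<in> {z. 1 < Arg z \<and> Arg z < pi - 1}"
      using pi_gt3 by auto
  qed
  ultimately have "filterlim (\<lambda>x. \<i> * of_real x) (sector_infinity 1) (at_top :: real filter)"
    by (simp add: sector_infinity_def filterlim_inf filterlim_principal)
  thus ?thesis
    by (auto simp: filterlim_def bot_unique filtermap_bot_iff)
qed

lemma smallo_cmult_iff:
  fixes f g :: "complex \<Rightarrow> complex"
  shows "(\<lambda>x. c * f x) \<in> o[F](g) \<longleftrightarrow> c = 0 \<or> f \<in> o[F](g)"
  by (cases "c = 0") auto

lemma inverse_power_smallo_sector_infinity:
  assumes "m > n"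
  shows "(\<lambda>z. 1 / z ^ m) \<in> o[sector_infinity e](\<lambda>z. 1 / z ^ n :: complex)"
proof -
  have "((\<lambda>z. inverse z ^ (m - n)) \<longlongrightarrow> 0 ^ (m - n)) (sector_infinity e)"
    using tendsto_inverse_0 sector_infinity_le_at_infinity
    by (intro tendsto_power) (rule tendsto_mono)
  moreover have "eventually (\<lambda>z::complex. inverse z ^ (m - n) =
      (1 / z ^ m) / (1 / z ^ n)) (sector_infinity e)"
    using eventually_nonzero_sector_infinity
    by eventually_elim (use assms in \<open>simp add: field_simps flip: power_add\<close>)
  ultimately have "((\<lambda>z. (1 / z ^ m) / (1 / z ^ n :: complex)) \<longlongrightarrow> 0) (sector_infinity e)"
    using assms by (simp add: tendsto_cong zero_power)
  thus ?thesis
  proof (rule smalloI_tendsto)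
    show "eventually (\<lambda>z. 1 / z ^ n \<noteq> (0::complex)) (sector_infinity e)"
      using eventually_nonzero_sector_infinity by eventually_elim simp
  qed
qed

lemma inverse_power_bigo_sector_infinity:
  assumes "m \<ge> n"
  shows "(\<lambda>z. 1 / z ^ m) \<in> O[sector_infinity e](\<lambda>z. 1 / z ^ n :: complex)"
  using inverse_power_smallo_sector_infinity[of n m e] assms
  by (cases "m = n") (auto intro: landau_o.small_imp_big)

definition fps_partial :: "nat \<Rightarrow> real fps \<Rightarrow> complex \<Rightarrow> complex" where
  "fps_partial N A z = (\<Sum>j\<le>N. of_real (fps_nth A j) / z ^ j)"

text \<open>
  Unlike \<^const>\<open>has_expansion\<close>, this allows a constant term and every order of truncation, which makes
  the notion closed under products and quotients.
\<close>

definition asymp_series :: "(complex \<Rightarrow> complex) \<Rightarrow> real fps \<Rightarrow> bool" where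
  "asymp_series f A \<longleftrightarrow>
     (\<forall>e>0. \<forall>N. (\<lambda>z. f z - fps_partial N A z) \<in> o[sector_infinity e](\<lambda>z. 1 / z ^ N))"

lemma asymp_seriesD:
  "asymp_series f A \<Longrightarrow> e > 0 \<Longrightarrow>
     (\<lambda>z. f z - fps_partial N A z) \<in> o[sector_infinity e](\<lambda>z. 1 / z ^ N)"
  by (simp add: asymp_series_def)

lemma sum_inverse_powers_smallo:
  assumes "\<And>j. j \<in> S \<Longrightarrow> j > N"
  shows "(\<lambda>z. \<Sum>j\<in>S. of_real (a j) / z ^ j) \<in> o[sector_infinity e](\<lambda>z. 1 / z ^ N :: complex)"
proof (rule big_sum_in_smallo)
  fix j assume "j \<in> S"
  hence "(\<lambda>z. of_real (a j) * (1 / z ^ j)) \<in> o[sector_infinity e](\<lambda>z. 1 / z ^ N :: complex)"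
    using inverse_power_smallo_sector_infinity[of N j e] assms
    unfolding smallo_cmult_iff by blast
  thus "(\<lambda>z. of_real (a j) / z ^ j) \<in> o[sector_infinity e](\<lambda>z. 1 / z ^ N :: complex)"
    by simp
qed

lemma fps_partial_diff_smallo:
  assumes "N \<le> M"
  shows "(\<lambda>z. fps_partial M A z - fps_partial N A z) \<in> o[sector_infinity e](\<lambda>z. 1 / z ^ N)"
proof -
  have "fps_partial M A z - fps_partial N A z =
      (\<Sum>j\<in>{N<..M}. of_real (fps_nth A j) / z ^ j)" for z
  proof -
    have "{..M} = {..N} \<union> {N<..M}" "{..N} \<inter> {N<..M} = {}" using assms by auto
    thus ?thesis unfolding fps_partial_def
      by (simp add: sum.union_disjoint)
  qed
  thus ?thesis
    using sum_inverse_powers_smallo[of "{N<..M}" N "fps_nth A" e] by simp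
qed

text \<open>
  Longer partial sums may be used than the error bound asks for, since the additional terms are
  themselves within the error.
\<close>

lemma asymp_seriesI:
  assumes "\<And>e N. e > 0 \<Longrightarrow>
    \<exists>M\<ge>N. (\<lambda>z. f z - fps_partial M A z) \<in> o[sector_infinity e](\<lambda>z. 1 / z ^ N)"
  shows "asymp_series f A"
  unfolding asymp_series_def
proof (intro allI impI)
  fix e :: real and N assume "e > 0"
  then obtain M where M: "M \<ge> N"
    "(\<lambda>z. f z - fps_partial M A z) \<in> o[sector_infinity e](\<lambda>z. 1 / z ^ N)"
    using assms by blast
  from sum_in_smallo(1)[OF M(2) fps_partial_diff_smallo[OF M(1), of A e]]
  show "(\<lambda>z. f z - fps_partial N A z) \<in> o[sector_infinity e](\<lambda>z. 1 / z ^ N)"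
    by (simp add: algebra_simps)
qed

lemma asymp_series_add:
  assumes "asymp_series f A" "asymp_series g B"
  shows "asymp_series (\<lambda>z. f z + g z) (A + B)"
  unfolding asymp_series_def
proof (intro allI impI)
  fix e :: real and N assume e: "e > 0"
  from sum_in_smallo(1)[OF asymp_seriesD[OF assms(1) e] asymp_seriesD[OF assms(2) e]]
  show "(\<lambda>z. (f z + g z) - fps_partial N (A + B) z) \<in> o[sector_infinity e](\<lambda>z. 1 / z ^ N)"
    by (simp add: fps_partial_def algebra_simps sum.distrib add_divide_distrib)
qed

lemma fps_partial_const: "fps_partial N (fps_const a) z = of_real a"
proof -
  have "fps_partial N (fps_const a) z = (\<Sum>j\<le>N. if j = 0 then of_real a else 0)"
    unfolding fps_partial_def by (intro sum.cong) auto
  thus ?thesis by simp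
qed

lemma asymp_series_const: "asymp_series (\<lambda>z. of_real a) (fps_const a)"
  by (simp add: asymp_series_def fps_partial_const)

lemma asymp_series_cmult:
  assumes "asymp_series f A"
  shows "asymp_series (\<lambda>z. of_real a * f z) (fps_const a * A)"
  unfolding asymp_series_def
proof (intro allI impI)
  fix e :: real and N assume e: "e > 0"
  have "(\<lambda>z. of_real a * (f z - fps_partial N A z)) \<in> o[sector_infinity e](\<lambda>z. 1 / z ^ N)"
    using asymp_seriesD[OF assms e] by simp
  thus "(\<lambda>z. of_real a * f z - fps_partial N (fps_const a * A) z)
      \<in> o[sector_infinity e](\<lambda>z. 1 / z ^ N)"
    by (simp add: fps_partial_def algebra_simps sum_distrib_left)
qed

lemma asymp_series_diff:
  assumes "asymp_series f A" "asymp_series g B"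
  shows "asymp_series (\<lambda>z. f z - g z) (A - B)"
  using asymp_series_add[OF assms(1) asymp_series_cmult[OF assms(2), of "-1"]]
  by (simp flip: fps_const_neg)

text \<open>
  The coefficients are shown to vanish one after the other: once those below \<open>j\<close> are zero, the term of
  order \<open>j\<close> dominates the remaining sum, so it could not be of smaller order.
\<close>

lemma fps_partial_smallo_imp_coeff_eq_0:
  assumes "fps_partial N A \<in> o[sector_infinity 1](\<lambda>z. 1 / z ^ N)" "j \<le> N"
  shows "fps_nth A j = 0"
  using assms(2)
proof (induction j rule: less_induct)
  case (less j)
  have "fps_partial N A = (\<lambda>z. of_real (fps_nth A j) / z ^ j +
           (\<Sum>i\<in>{j<..N}. of_real (fps_nth A i) / z ^ i))"
  proof
    fix z
    have "{..N} = {..<j} \<union> {j} \<union> {j<..N}" using less.prems by auto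
    thus "fps_partial N A z = of_real (fps_nth A j) / z ^ j +
           (\<Sum>i\<in>{j<..N}. of_real (fps_nth A i) / z ^ i)"
      unfolding fps_partial_def using less
      by (subst \<open>{..N} = _\<close>, subst sum.union_disjoint) (auto simp: sum.union_disjoint)
  qed
  moreover have "fps_partial N A \<in> o[sector_infinity 1](\<lambda>z. 1 / z ^ j)"
    using assms(1) inverse_power_bigo_sector_infinity[OF less.prems]
    by (rule landau_o.small_big_trans)
  ultimately have "(\<lambda>z. of_real (fps_nth A j) * (1 / z ^ j :: complex))
      \<in> o[sector_infinity 1](\<lambda>z. 1 / z ^ j)"
    using sum_in_smallo(2)[of "fps_partial N A" "sector_infinity 1" "\<lambda>z. 1 / z ^ j"
        "\<lambda>z. \<Sum>i\<in>{j<..N}. of_real (fps_nth A i) / z ^ i"]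
      sum_inverse_powers_smallo[of "{j<..N}" j "fps_nth A" 1] by simp
  hence "(\<lambda>z. of_real (fps_nth A j) * (1 / z ^ j :: complex)) \<in> o[sector_infinity 1](\<lambda>z. 1 / z ^ j)"
    by simp
  hence "fps_nth A j = 0 \<or> (\<lambda>z. 1 / z ^ j :: complex) \<in> o[sector_infinity 1](\<lambda>z. 1 / z ^ j)"
    unfolding smallo_cmult_iff by simp
  moreover have False if "eventually (\<lambda>z::complex. 1 / z ^ j = 0) (sector_infinity 1)"
  proof -
    have "eventually (\<lambda>z. False) (sector_infinity 1)"
      using that eventually_nonzero_sector_infinity[of 1] by eventually_elim auto
    thus False using sector_infinity_1_nontrivial by simp
  qed
  ultimately show ?case
    by (auto simp: landau_o.small_refl_iff)
qed

lemma asymp_series_smallo_imp_coeff_eq_0: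
  assumes "asymp_series f A" "f \<in> o[sector_infinity 1](\<lambda>z. 1 / z ^ N)" "j \<le> N"
  shows "fps_nth A j = 0"
proof (rule fps_partial_smallo_imp_coeff_eq_0[OF _ assms(3)])
  show "fps_partial N A \<in> o[sector_infinity 1](\<lambda>z. 1 / z ^ N)"
    using sum_in_smallo(2)[OF assms(2) asymp_seriesD[OF assms(1), of 1 N]] by simp
qed

lemma asymp_series_unique:
  assumes "asymp_series f A" "asymp_series f B"
  shows "A = B"
proof -
  have "asymp_series (\<lambda>z. 0) (A - B)" using asymp_series_diff[OF assms] by simp
  hence "fps_nth (A - B) j = 0" for j
    by (rule asymp_series_smallo_imp_coeff_eq_0[of _ _ j]) auto
  thus ?thesis by (simp add: fps_eq_iff)
qed

lemma asymp_series_cong: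
  assumes "\<And>z. z \<in> uhp \<Longrightarrow> f z = g z" "asymp_series f A"
  shows "asymp_series g A"
  unfolding asymp_series_def
proof (intro allI impI)
  fix e :: real and N assume e: "e > 0"
  have "eventually (\<lambda>z. g z - fps_partial N A z = f z - fps_partial N A z) (sector_infinity e)"
    using eventually_uhp_sector_infinity[OF e] by eventually_elim (simp add: assms)
  thus "(\<lambda>z. g z - fps_partial N A z) \<in> o[sector_infinity e](\<lambda>z. 1 / z ^ N)"
    using asymp_seriesD[OF assms(2) e, of N] by (subst landau_o.small.in_cong)
qed

lemma asymp_series_tendsto:
  assumes "asymp_series f A" "e > 0"
  shows "(f \<longlongrightarrow> of_real (fps_nth A 0)) (sector_infinity e)"
proof -
  have "(\<lambda>z. f z - of_real (fps_nth A 0)) \<in> o[sector_infinity e](\<lambda>z. 1)"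
    using asymp_seriesD[OF assms, of 0] by (simp add: fps_partial_def)
  hence "((\<lambda>z. f z - of_real (fps_nth A 0)) \<longlongrightarrow> 0) (sector_infinity e)"
    by (auto dest: smalloD_tendsto)
  thus ?thesis by (simp add: LIM_zero_iff)
qed

lemma asymp_series_times_id:
  assumes "asymp_series f A" "fps_nth A 0 = 0"
  shows "asymp_series (\<lambda>z. z * f z) (fps_shift 1 A)"
  unfolding asymp_series_def
proof (intro allI impI)
  fix e :: real and N assume e: "e > 0"
  have "(\<lambda>z. z * (f z - fps_partial (Suc N) A z)) \<in> o[sector_infinity e](\<lambda>z. z * (1 / z ^ Suc N))"
    by (intro landau_o.small.mult_left asymp_seriesD assms e)
  moreover have "eventually (\<lambda>z. z * (1 / z ^ Suc N) = 1 / z ^ N) (sector_infinity e)"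
    using eventually_nonzero_sector_infinity by eventually_elim simp
  moreover have "eventually (\<lambda>z. z * (f z - fps_partial (Suc N) A z) =
       z * f z - fps_partial N (fps_shift 1 A) z) (sector_infinity e)"
    using eventually_nonzero_sector_infinity
  proof eventually_elim
    case (elim z)
    have "z * fps_partial (Suc N) A z = (\<Sum>j\<le>N. z * (of_real (fps_nth A (Suc j)) / z ^ Suc j))"
      unfolding fps_partial_def sum.atMost_Suc_shift
          by (simp add: assms sum_distrib_left ring_distribs)
    also have "\<dots> = fps_partial N (fps_shift 1 A) z"
      unfolding fps_partial_def using elim by (intro sum.cong) auto
    finally show ?case by (simp add: ring_distribs)
  qed
  ultimately show "(\<lambda>z. z * f z - fps_partial N (fps_shift 1 A) z)
      \<in> o[sector_infinity e](\<lambda>z. 1 / z ^ N)"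
    by (simp add: landau_o.small.in_cong landau_o.small.cong)
qed

text \<open>
  Multiplication by a power of \<open>z\<close> is admissible only as far as it creates no polynomial part.
\<close>

lemma asymp_series_times_power:
  assumes "asymp_series f A" "\<And>j. j < m \<Longrightarrow> fps_nth A j = 0"
  shows "asymp_series (\<lambda>z. z ^ m * f z) (fps_shift m A)"
  using assms(2)
proof (induction m)
  case (Suc m)
  have "asymp_series (\<lambda>z. z * (z ^ m * f z)) (fps_shift 1 (fps_shift m A))"
    using Suc by (intro asymp_series_times_id) auto
  moreover have "fps_shift 1 (fps_shift m A) = fps_shift (Suc m) A"
    by (rule fps_ext) simp
  ultimately show ?case by (simp add: mult_ac)
qed (use assms in auto)

lemma asymp_series_bigo_1:
  assumes "asymp_series f A" "e > 0"
  shows "f \<in> O[sector_infinity e](\<lambda>z. 1)"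
  using bigoI_tendsto[of f "\<lambda>z. 1"] asymp_series_tendsto[OF assms] by simp

lemma fps_partial_bigo_1:
  "fps_partial N A \<in> O[sector_infinity e](\<lambda>z. 1)"
  unfolding fps_partial_def
proof (rule big_sum_in_bigo)
  fix j
  have "(\<lambda>z. of_real (fps_nth A j) * (1 / z ^ j)) \<in> O[sector_infinity e](\<lambda>z. 1 / z ^ 0 :: complex)"
    using inverse_power_bigo_sector_infinity[of 0 j e] unfolding cmult_in_bigo_iff by simp
  thus "(\<lambda>z. of_real (fps_nth A j) / z ^ j) \<in> O[sector_infinity e](\<lambda>z. 1 :: complex)"
    by simp
qed

text \<open>
  The product of two partial sums contains all the terms of the Cauchy product up to order \<open>N\<close>; what is
  left over has order above \<open>N\<close>.
\<close>

lemma fps_partial_mult_smallo: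
  "(\<lambda>z. fps_partial N A z * fps_partial N B z - fps_partial N (A * B) z)
     \<in> o[sector_infinity e](\<lambda>z. 1 / z ^ N)"
proof -
  define T where "T = {(i, j). i \<le> N \<and> j \<le> N \<and> i + j > N}"
  define c where "c = (\<lambda>(i, j). fps_nth A i * fps_nth B j)"
  have "fps_partial N A z * fps_partial N B z - fps_partial N (A * B) z =
          (\<Sum>x\<in>T. of_real (c x) / z ^ (fst x + snd x))" for z
  proof -
    have fin: "finite {(i, j). i + j \<le> N}"
      by (rule finite_subset[of _ "{..N} \<times> {..N}"]) auto
    have "fps_partial N A z * fps_partial N B z =
            (\<Sum>x\<in>{..N} \<times> {..N}. of_real (c x) / z ^ (fst x + snd x))"
      unfolding fps_partial_def sum_product sum.cartesian_product
      by (intro sum.cong) (auto simp: c_def power_add)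
    also have "{..N} \<times> {..N} = {(i, j). i + j \<le> N} \<union> T"
      by (auto simp: T_def)
    also have "(\<Sum>x\<in>\<dots>. of_real (c x) / z ^ (fst x + snd x)) =
        (\<Sum>(i, j)\<in>{(i, j). i + j \<le> N}. of_real (c (i, j)) / z ^ (i + j)) +
        (\<Sum>x\<in>T. of_real (c x) / z ^ (fst x + snd x))"
    proof (subst sum.union_disjoint)
      show "finite T" by (rule finite_subset[of _ "{..N} \<times> {..N}"]) (auto simp: T_def)
    qed (use fin in \<open>auto simp: T_def case_prod_unfold\<close>)
    also have "(\<Sum>(i, j)\<in>{(i, j). i + j \<le> N}. of_real (c (i, j)) / z ^ (i + j)) =
        fps_partial N (A * B) z"
      unfolding sum.triangle_reindex_eq fps_partial_def fps_mult_nth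
      by (intro sum.cong) (auto simp: c_def sum_divide_distrib atLeast0AtMost)
    finally show ?thesis by simp
  qed
  moreover have "(\<lambda>z. \<Sum>x\<in>T. of_real (c x) / z ^ (fst x + snd x))
      \<in> o[sector_infinity e](\<lambda>z. 1 / z ^ N :: complex)"
  proof (rule big_sum_in_smallo)
    fix x assume "x \<in> T"
    hence "(\<lambda>z. of_real (c x) * (1 / z ^ (fst x + snd x)))
        \<in> o[sector_infinity e](\<lambda>z. 1 / z ^ N :: complex)"
      using inverse_power_smallo_sector_infinity[of N "fst x + snd x" e]
      unfolding smallo_cmult_iff by (auto simp: T_def)
    thus "(\<lambda>z. of_real (c x) / z ^ (fst x + snd x))
        \<in> o[sector_infinity e](\<lambda>z. 1 / z ^ N :: complex)"
      by simp
  qed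
  ultimately show ?thesis by simp
qed

lemma asymp_series_mult:
  assumes "asymp_series f A" "asymp_series g B"
  shows "asymp_series (\<lambda>z. f z * g z) (A * B)"
  unfolding asymp_series_def
proof (intro allI impI)
  fix e :: real and N assume e: "e > 0"
  let ?o = "o[sector_infinity e](\<lambda>z. 1 / z ^ N)"
  have "(\<lambda>z. (f z - fps_partial N A z) * g z) \<in> ?o"
    using landau_o.small_big_mult[OF asymp_seriesD[OF assms(1) e] asymp_series_bigo_1[OF
        assms(2) e], of N]
    by simp
  moreover have "(\<lambda>z. (g z - fps_partial N B z) * fps_partial N A z) \<in> ?o"
    using landau_o.small_big_mult[OF asymp_seriesD[OF
        assms(2) e] fps_partial_bigo_1[of N A e], of N]
    by simp
  ultimately have "(\<lambda>z. (f z - fps_partial N A z) * g z + (g z -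
      fps_partial N B z) * fps_partial N A z +
      (fps_partial N A z * fps_partial N B z - fps_partial N (A * B) z)) \<in> ?o"
    by (intro sum_in_smallo fps_partial_mult_smallo)
  thus "(\<lambda>z. f z * g z - fps_partial N (A * B) z) \<in> ?o"
    by (simp add: algebra_simps)
qed

lemma asymp_series_fps_partial:
  "asymp_series (fps_partial M A) (Abs_fps (\<lambda>j. if j \<le> M then fps_nth A j else 0))"
proof (rule asymp_seriesI, intro exI conjI)
  fix e :: real and N
  \<comment> \<open>The function is a finite sum, so it equals all its later partial sums.\<close>
  have "fps_partial (max M N) (Abs_fps (\<lambda>j. if j \<le> M then fps_nth A j else 0)) = fps_partial M A"
    unfolding fps_partial_def by (intro ext sum.mono_neutral_cong_right) auto
  thus "(\<lambda>z. fps_partial M A z -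
         fps_partial (max M N) (Abs_fps (\<lambda>j. if j \<le> M then fps_nth A j else 0)) z)
       \<in> o[sector_infinity e](\<lambda>z. 1 / z ^ N)"
    by simp
qed auto

text \<open>
  The denominator may vanish at infinity to some order \<open>m\<close>, as long as the quotient of the formal series
  exists. Truncating the quotient series at order \<open>N + m\<close> makes \<open>f - C g\<close> small to that order, and
  the division by \<open>g\<close> costs \<open>m\<close> orders.
\<close>

lemma asymp_series_divide:
  assumes f: "asymp_series f A" and g: "asymp_series g B" and "B \<noteq> 0" and CB: "C * B = A"
  shows "asymp_series (\<lambda>z. f z / g z) C"
proof (rule asymp_seriesI, intro exI conjI)
  fix e :: real and N assume e: "e > 0"
  define m where "m = subdegree B"
  define M where "M = N + m"
  \<comment> \<open>The truncated quotient agrees with C, hence C' * B with A, up to order M.\<close>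
  define C' where "C' = Abs_fps (\<lambda>j. if j \<le> M then fps_nth C j else 0)"
  have D: "asymp_series (\<lambda>z. f z - fps_partial M C z * g z) (A - C' * B)"
    unfolding C'_def by (intro asymp_series_diff asymp_series_mult f g asymp_series_fps_partial)
  have "fps_nth (A - C' * B) j = 0" if "j \<le> M" for j
    using that unfolding CB[symmetric] C'_def fps_sub_nth fps_mult_nth right_minus_eq
    by (intro sum.cong) auto
  hence 0: "fps_partial M (A - C' * B) z = 0" for z by (simp add: fps_partial_def)
  have 1: "(\<lambda>z. f z - fps_partial M C z * g z) \<in> o[sector_infinity e](\<lambda>z. 1 / z ^ M)"
    using asymp_seriesD[OF D e, of M] by (simp only: 0 diff_zero)
  have "asymp_series (\<lambda>z. z ^ m * g z) (fps_shift m B)"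
  proof (rule asymp_series_times_power[OF g])
    show "fps_nth B j = 0" if "j < m" for j
      using that unfolding m_def by (rule nth_less_subdegree_zero)
  qed
  hence lim: "((\<lambda>z. z ^ m * g z) \<longlongrightarrow> of_real (fps_nth B m)) (sector_infinity e)"
    using asymp_series_tendsto[of _ "fps_shift m B", OF _ e] by simp
  have Bm: "fps_nth B m \<noteq> 0" using \<open>B \<noteq> 0\<close> by (simp add: m_def)
  have "(\<lambda>z. inverse (z ^ m * g z)) \<in> O[sector_infinity e](\<lambda>z. 1)"
    using bigoI_tendsto[of "\<lambda>z. inverse (z ^ m * g z)" "\<lambda>z. 1"] tendsto_inverse[OF lim] Bm by simp
  hence "(\<lambda>z. z ^ m * inverse (z ^ m * g z)) \<in> O[sector_infinity e](\<lambda>z. z ^ m * 1)"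
    by (rule landau_o.big.mult_left)
  hence "(\<lambda>z. (f z - fps_partial M C z * g z) * (z ^ m * inverse (z ^ m * g z)))
     \<in> o[sector_infinity e](\<lambda>z. 1 / z ^ M * (z ^ m * 1))"
    by (rule landau_o.small_big_mult[OF 1])
  also have "?this \<longleftrightarrow> (\<lambda>z. f z / g z - fps_partial M C z) \<in> o[sector_infinity e](\<lambda>z. 1 / z ^ N)"
  proof (rule landau_o.small.cong_ex)
    show "eventually (\<lambda>z. 1 / z ^ M * (z ^ m * 1) = 1 / z ^ N) (sector_infinity e)"
      using eventually_nonzero_sector_infinity by eventually_elim (simp add: M_def power_add)
    have "eventually (\<lambda>z. z ^ m * g z \<noteq> 0) (sector_infinity e)"
      using tendsto_imp_eventually_ne[OF lim, of 0] Bm by simp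
    thus "eventually (\<lambda>z. (f z - fps_partial M C z * g z) * (z ^ m * inverse (z ^ m * g z)) =
      f z / g z - fps_partial M C z) (sector_infinity e)"
      by eventually_elim (simp add: field_simps)
  qed
  finally show "(\<lambda>z. f z / g z - fps_partial M C z) \<in> o[sector_infinity e](\<lambda>z. 1 / z ^ N)" .
qed auto

text \<open>
  The index shift and the sign translate the convention \<open>- s\<^sub>j / z\<^bsup>j+1\<^esup>\<close> of \<^const>\<open>has_expansion\<close>.
\<close>

definition expansion_fps :: "(nat \<Rightarrow> real) \<Rightarrow> real fps" where
  "expansion_fps s = - fps_X * Abs_fps s"

lemma expansion_fps_nth [simp]:
  "fps_nth (expansion_fps s) 0 = 0" "fps_nth (expansion_fps s) (Suc j) = - s j"
  by (simp_all add: expansion_fps_def)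

text \<open>
  \<^const>\<open>has_expansion\<close> only speaks of partial sums ending with an even index. The missing ones are
  recovered from longer ones by \<open>asymp_seriesI\<close>.
\<close>

lemma has_expansion_iff_asymp_series:
  "has_expansion F s \<longleftrightarrow> asymp_series F (expansion_fps s)"
proof -
  have eq: "fps_partial (Suc N) (expansion_fps s) z = (\<Sum>j\<le>N. - of_real (s j) / z ^ (j + 1))" for N z
    unfolding fps_partial_def sum.atMost_Suc_shift by simp
  show ?thesis
  proof
    assume *: "has_expansion F s"
    show "asymp_series F (expansion_fps s)"
    proof (rule asymp_seriesI, intro exI conjI)
      fix e :: real and N assume "e > 0"
      hence "(\<lambda>z. F z - fps_partial (Suc (2 * N)) (expansion_fps s) z)
          \<in> o[sector_infinity e](\<lambda>z. 1 / z ^ (2 * N + 1))"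
        using * unfolding has_expansion_def eq by blast
      thus "(\<lambda>z. F z - fps_partial (Suc (2 * N)) (expansion_fps s) z)
          \<in> o[sector_infinity e](\<lambda>z. 1 / z ^ N)"
        by (rule landau_o.small_big_trans) (rule inverse_power_bigo_sector_infinity, simp)
    qed auto
  next
    assume "asymp_series F (expansion_fps s)"
    thus "has_expansion F s"
      unfolding has_expansion_def eq[symmetric]
      using asymp_seriesD[of F "expansion_fps s" _ "Suc _"] by simp
  qed
qed

lemma expansion_fps_Abs:
  assumes "fps_nth A 0 = 0"
  shows "expansion_fps (\<lambda>j. - fps_nth A (Suc j)) = A"
proof (rule fps_ext)
  show "fps_nth (expansion_fps (\<lambda>j. - fps_nth A (Suc j))) n = fps_nth A n" for n
    using assms by (cases n) auto
qed

lemma has_expansion_unique: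
  assumes "has_expansion F s" "has_expansion F t"
  shows "s = t"
proof -
  have "expansion_fps s = expansion_fps t"
    using assms asymp_series_unique unfolding has_expansion_iff_asymp_series by blast
  hence "- s j = - t j" for j
    unfolding expansion_fps_nth(2)[symmetric] by simp
  thus ?thesis by auto
qed

lemma asymp_series_eventually_nonzero:
  assumes "asymp_series f A" "A \<noteq> 0" "e > 0"
  shows "eventually (\<lambda>z. f z \<noteq> 0) (sector_infinity e)"
proof -
  have "asymp_series (\<lambda>z. z ^ subdegree A * f z) (fps_shift (subdegree A) A)"
    by (rule asymp_series_times_power[OF assms(1)]) (rule nth_less_subdegree_zero)
  from asymp_series_tendsto[OF this assms(3)]
  have "((\<lambda>z. z ^ subdegree A * f z) \<longlongrightarrow> of_real (fps_nth A (subdegree A))) (sector_infinity e)"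
    by simp
  hence "eventually (\<lambda>z. z ^ subdegree A * f z \<noteq> 0) (sector_infinity e)"
    by (rule tendsto_imp_eventually_ne) (use assms(2) in simp)
  thus ?thesis by eventually_elim simp
qed

lemma open_uhp: "open uhp"
  by (simp add: uhp_def open_halfspace_Im_gt)

lemma connected_uhp: "connected uhp"
  by (simp add: uhp_def convex_connected convex_halfspace_Im_gt)

text \<open>
  A nontrivial expansion at infinity rules out that \<open>f\<close> is identically zero, and then its zeros are
  isolated because the half plane is connected.
\<close>

lemma eventually_nonzero_cosparse_uhp:
  assumes f: "f holomorphic_on uhp" and A: "asymp_series f A" "A \<noteq> 0"
  shows "eventually (\<lambda>z. f z \<noteq> 0) (cosparse uhp)"
proof -
  have "eventually (\<lambda>z. f z \<noteq> 0 \<and> z \<in> uhp) (sector_infinity 1)"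
    using asymp_series_eventually_nonzero[OF A, of 1] eventually_uhp_sector_infinity[of 1]
    by (simp add: eventually_conj_iff)
  then obtain z0 where z0: "f z0 \<noteq> 0" "z0 \<in> uhp"
    using eventually_happens'[OF sector_infinity_1_nontrivial] by blast
  show ?thesis unfolding eventually_cosparse_open_eq[OF open_uhp]
  proof
    fix z assume z: "z \<in> uhp"
    show "eventually (\<lambda>w. f w \<noteq> 0) (at z)"
    proof (cases "f z = 0")
      case True
      then obtain r where "r > 0" "\<And>w. w \<in> ball z r - {z} \<Longrightarrow> f w \<noteq> 0"
        using isolated_zeros[OF f open_uhp connected_uhp z _ z0(2,1)] by metis
      thus ?thesis
        unfolding eventually_at by (intro exI[of _ r]) (auto simp: dist_commute)
    next
      case False
      have "isCont f z"
        using f z open_uhp holomorphic_on_imp_continuous_on continuous_on_eq_continuous_at by blast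
      thus ?thesis using False by (intro
          tendsto_imp_eventually_ne[of f "f z"]) (auto simp: isCont_def)
    qed
  qed
qed

lemma first_coeff_eqI:
  assumes "\<And>i. i < m \<Longrightarrow> s i = 0" "s m \<noteq> 0"
  shows "first_coeff s = s m"
proof -
  have "(LEAST j. s j \<noteq> 0) = m"
    using assms by (intro Least_equality) (auto simp: not_less[symmetric])
  thus ?thesis by (simp add: first_coeff_def)
qed

text \<open>
  The added constant cancels the term of order 0 that multiplication by \<open>z\<close> produces.
\<close>

lemma has_expansion_times_id:
  assumes "has_expansion F s"
  shows "has_expansion (\<lambda>z. z * F z + of_real (s 0)) (\<lambda>j. s (Suc j))"
proof -
  have "asymp_series (\<lambda>z. z * F z + of_real (s 0)) (fps_shift 1 (expansion_fps s) +
      fps_const (s 0))"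
    using assms unfolding has_expansion_iff_asymp_series
    by (intro asymp_series_add asymp_series_times_id asymp_series_const) auto
  also have "fps_shift 1 (expansion_fps s) + fps_const (s 0) = expansion_fps (\<lambda>j. s (Suc j))"
  proof (rule fps_ext)
    show "fps_nth (fps_shift 1 (expansion_fps s) + fps_const (s 0)) i =
            fps_nth (expansion_fps (\<lambda>j. s (Suc j))) i" for i
      by (cases i) auto
  qed
  finally show ?thesis unfolding has_expansion_iff_asymp_series .
qed

lemma has_expansion_divide_const:
  assumes "has_expansion F s"
  shows "has_expansion (\<lambda>z. F z / of_real a) (\<lambda>j. s j / a)"
proof -
  have "asymp_series (\<lambda>z. of_real (1 / a) * F z) (fps_const (1 / a) * expansion_fps s)"
    using assms unfolding has_expansion_iff_asymp_series by (rule asymp_series_cmult)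
  also have "fps_const (1 / a) * expansion_fps s = expansion_fps (\<lambda>j. s j / a)"
  proof (rule fps_ext)
    show "fps_nth (fps_const (1 / a) * expansion_fps s) i =
        fps_nth (expansion_fps (\<lambda>j. s j / a)) i" for i
      by (cases i) auto
  qed
  finally show ?thesis unfolding has_expansion_iff_asymp_series by simp
qed

lemma normal_index_divide_const:
  assumes "a \<noteq> 0"
  shows "normal_index (\<lambda>j. s j / a) = normal_index s"
proof -
  have "hankel_det (\<lambda>j. s j / a) m = (1 / a) ^ m * hankel_det s m" for m
  proof -
    have "Matrix.mat m m (\<lambda>(i, k). s (i + k) / a) = (1 / a) \<cdot>\<^sub>m Matrix.mat m m (\<lambda>(i, k). s (i + k))"
      by (rule eq_matI) auto
    thus ?thesis unfolding hankel_det_def by simp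
  qed
  thus ?thesis using assms by (simp add: normal_index_def normal_indices_def)
qed

section \<open>Monic orthogonal polynomials and shifted Hankel determinants\<close>

text \<open>
  All that is needed of the measure is the moment functional \<open>\<phi>\<close>, which integrates polynomials,
  together with the recurrence of its monic orthogonal polynomials.
\<close>

locale monic_orthogonal_polynomials =
  fixes \<phi> :: "real poly \<Rightarrow> real" and P :: "nat \<Rightarrow> real poly" and b c :: "nat \<Rightarrow> real"
  assumes phi_add: "\<phi> (p + q) = \<phi> p + \<phi> q"
    and phi_smult: "\<phi> (Polynomial.smult a p) = a * \<phi> p"
    and P_0: "P 0 = 1"
    and recurrence: "[:0, 1:] * P j = P (Suc j) + Polynomial.smult (b j) (P j) +
               (if j = 0 then 0 else Polynomial.smult (c (j - 1)) (P (j - 1)))"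
    and phi_P_Suc: "\<phi> (P (Suc j)) = 0"
    and phi_1_pos: "\<phi> 1 > 0"
    and c_pos: "c j > 0"
    and degree_P: "degree (P j) = j"
    and lead_coeff_P: "lead_coeff (P j) = 1"
begin

text \<open>
  This is \<open>\<phi> (P m * P m)\<close>, the squared norm of the \<open>m\<close>-th orthogonal polynomial; the product
  formula comes from \<open>c m = sq_norm (m + 1) / sq_norm m\<close>.
\<close>

definition sq_norm :: "nat \<Rightarrow> real" where
  "sq_norm m = \<phi> 1 * (\<Prod>i<m. c i)"

lemma sq_norm_pos: "sq_norm m > 0"
  unfolding sq_norm_def using phi_1_pos c_pos by (intro mult_pos_pos prod_pos) auto

lemma sq_norm_0: "sq_norm 0 = \<phi> 1" and sq_norm_Suc: "sq_norm (Suc m) = c m * sq_norm m"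
  by (simp_all add: sq_norm_def)

lemma phi_0 [simp]: "\<phi> 0 = 0"
  using phi_smult[of 0 0] by simp

lemma phi_diff: "\<phi> (p - q) = \<phi> p - \<phi> q"
  using phi_add[of "p - q" q] by simp

lemma phi_sum: "\<phi> (\<Sum>i\<in>S. f i) = (\<Sum>i\<in>S. \<phi> (f i))"
  by (induction S rule: infinite_finite_induct) (simp_all add: phi_add)

text \<open>
  This contains both the orthogonality of \<open>P m\<close> to all lower degrees and the value of its norm. Both
  follow by moving one factor \<open>x\<close> at a time from \<open>q\<close> to \<open>P m\<close> with the recurrence; of the three
  resulting terms only the one with \<open>P (m - 1)\<close> survives.
\<close>

lemma phi_P_mult:
  assumes "degree q \<le> m"
  shows "\<phi> (P m * q) = coeff q m * sq_norm m"
  using assms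
proof (induction q arbitrary: m)
  case (pCons a q)
  show ?case
  proof (cases m)
    case 0
    hence "q = 0" using pCons.prems by (cases "q = 0") auto
    moreover have "\<phi> [:a:] = a * \<phi> 1" using phi_smult[of a 1] by simp
    ultimately show ?thesis using 0 by (simp add: P_0 sq_norm_0)
  next
    case (Suc k)
    have deg: "degree q \<le> k" using pCons.prems Suc by (cases "q = 0") auto
    have "P m * pCons a q = Polynomial.smult a (P m) + ([:0, 1:] * P m) * q"
      by (simp add: algebra_simps)
    also have "[:0, 1:] * P m =
        P (Suc m) + Polynomial.smult (b m) (P m) + Polynomial.smult (c k) (P k)"
      using recurrence[of m] Suc by simp
    also have "\<phi> (Polynomial.smult a (P m) + \<dots> * q) =
       a * \<phi> (P m) + \<phi> (P (Suc m) * q) + b m * \<phi> (P m * q) + c k * \<phi> (P k * q)"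
      by (simp add: ring_distribs phi_add phi_smult)
    also have "\<dots> = c k * (coeff q k * sq_norm k)"
      using pCons.IH[of "Suc m"] pCons.IH[of m] pCons.IH[of k] deg Suc
      by (simp add: phi_P_Suc coeff_eq_0)
    finally show ?thesis by (simp add: Suc sq_norm_Suc)
  qed
qed simp

definition moment :: "nat \<Rightarrow> real" where
  "moment j = \<phi> (monom 1 j)"

text \<open>
  The shifted Hankel matrix is the Gram matrix of the monomials for the functional \<open>x \<phi>\<close>.
\<close>

lemma hankel_mult_coeff:
  assumes "degree q < n"
  shows "(\<Sum>k<n. moment (Suc (i + k)) * coeff q k) = \<phi> (monom 1 i * ([:0, 1:] * q))"
proof -
  have "q = (\<Sum>k<n. monom (coeff q k) k)"
    by (rule poly_eqI) (use assms in \<open>auto simp: coeff_sum coeff_eq_0\<close>)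
  hence "monom 1 i * ([:0, 1:] * q) = monom 1 i * ([:0, 1:] * (\<Sum>k<n. monom (coeff q k) k))"
    by (rule arg_cong)
  also have "\<dots> = (\<Sum>k<n. Polynomial.smult (coeff q k) (monom 1 (Suc (i + k))))"
    by (simp add: sum_distrib_left mult_monom smult_monom monom_Suc algebra_simps flip: monom_0)
  finally show ?thesis by (simp add: phi_sum phi_smult moment_def mult.commute)
qed

text \<open>
  A kernel vector of the shifted Hankel matrix is a nonzero polynomial \<open>q\<close> of degree below \<open>n\<close> such
  that \<open>x q\<close> is orthogonal to all polynomials of degree below \<open>n\<close>. As \<open>x q\<close> has degree at most \<open>n\<close>, it
  is then a multiple of \<open>P n\<close>, so that \<open>P n\<close> vanishes at 0. Conversely, \<open>P n / x\<close> is such a \<open>q\<close>.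
\<close>

lemma hankel_det_shifted_eq_0_iff:
  "hankel_det (\<lambda>j. moment (Suc j)) n = 0 \<longleftrightarrow> poly (P n) 0 = 0"
proof -
  define A where "A = Matrix.mat n n (\<lambda>(i, k). moment (Suc (i + k)))"
  have A: "A \<in> carrier_mat n n" by (simp add: A_def)
  have Av: "(A *\<^sub>v Matrix.vec n (coeff q)) = 0\<^sub>v n \<longleftrightarrow>
              (\<forall>i<n. \<phi> (monom 1 i * ([:0, 1:] * q)) = 0)" if "degree q < n" for q
    using hankel_mult_coeff[OF that]
    by (auto simp: A_def vec_eq_iff scalar_prod_def atLeast0LessThan)
  have vec_0: "Matrix.vec n (coeff q) = 0\<^sub>v n \<longleftrightarrow> q = 0" if "degree q < n" for q :: "real poly"
  proof -
    have "q = 0" if "\<forall>k<n. coeff q k = 0"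
      using that \<open>degree q < n\<close> leading_coeff_0_iff by blast
    moreover have "Matrix.vec n (coeff q) = 0\<^sub>v n \<longleftrightarrow> (\<forall>k<n. coeff q k = 0)"
      by (auto simp: vec_eq_iff)
    ultimately show ?thesis by auto
  qed
  have "hankel_det (\<lambda>j. moment (Suc j)) n = 0 \<longleftrightarrow>
      (\<exists>v. v \<in> carrier_vec n \<and> v \<noteq> 0\<^sub>v n \<and> A *\<^sub>v v = 0\<^sub>v n)"
    unfolding hankel_det_def A_def[symmetric] by (rule det_0_iff_vec_prod_zero_field[OF A])
  also have "\<dots> \<longleftrightarrow> poly (P n) 0 = 0"
  proof
    assume "\<exists>v. v \<in> carrier_vec n \<and> v \<noteq> 0\<^sub>v n \<and> A *\<^sub>v v = 0\<^sub>v n"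
    then obtain v where v: "v \<in> carrier_vec n" "v \<noteq> 0\<^sub>v n" "A *\<^sub>v v = 0\<^sub>v n" by blast
    have n: "n > 0" using v by (cases n) auto
    define q where "q = (\<Sum>k<n. monom (vec_index v k) k)"
    have coeff_q: "coeff q k = (if k < n then vec_index v k else 0)" for k
      by (auto simp: q_def coeff_sum)
    have deg: "degree q < n"
      using n by (metis coeff_q degree_0 leading_coeff_0_iff)
    have v_eq: "v = Matrix.vec n (coeff q)" using v(1) by (auto simp: coeff_q)
    have "q \<noteq> 0" using v(2) vec_0[OF deg] v_eq by simp
    have orth: "\<phi> (r * ([:0, 1:] * q)) = 0" if "degree r < n" for r
    proof -
      have "r = (\<Sum>i<n. Polynomial.smult (coeff r i) (monom 1 i))"
        by (rule poly_eqI) (use that in \<open>auto simp: coeff_sum coeff_eq_0 smult_monom\<close>)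
      hence "\<phi> (r * ([:0, 1:] * q)) =
          \<phi> ((\<Sum>i<n. Polynomial.smult (coeff r i) (monom 1 i)) * ([:0, 1:] * q))"
        by (rule arg_cong)
      also have "\<dots> = (\<Sum>i<n. coeff r i * \<phi> (monom 1 i * ([:0, 1:] * q)))"
        unfolding sum_distrib_right mult_smult_left phi_sum phi_smult ..
      finally have "\<phi> (r * ([:0, 1:] * q)) = (\<Sum>i<n. coeff r i * \<phi> (monom 1 i * ([:0, 1:] * q)))" .
      thus ?thesis using Av[OF deg] v(3) v_eq by simp
    qed
    \<comment> \<open>Both terms are orthogonal to all degrees below n, and their difference has degree below n.\<close>
    define r where "r = [:0, 1:] * q - Polynomial.smult (coeff ([:0, 1:] * q) n) (P n)"
    have "r = 0"
    proof (rule ccontr)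
      assume "r \<noteq> 0"
      have "coeff (P n) n = 1" using lead_coeff_P[of n] by (simp add: degree_P)
      hence "coeff r n = 0" by (simp add: r_def)
      moreover have "degree r \<le> n"
        unfolding r_def using deg degree_mult_le[of "[:0, 1:]" q]
        by (intro degree_diff_le) (auto simp: degree_P)
      ultimately have d: "degree r < n"
        using \<open>r \<noteq> 0\<close> by (metis le_neq_implies_less leading_coeff_0_iff)
      have "\<phi> (P (degree r) * r) = \<phi> (P (degree r) * ([:0, 1:] * q)) -
               coeff ([:0, 1:] * q) n * \<phi> (P n * P (degree r))"
        unfolding r_def by (simp add: ring_distribs phi_diff phi_smult mult.commute)
      also have "\<dots> = 0"
      proof -
        have "\<phi> (P (degree r) * ([:0, 1:] * q)) = 0" using d by (intro orth) (simp add: degree_P)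
        moreover have "\<phi> (P n * P (degree r)) = 0"
          using d phi_P_mult[of "P (degree r)" n] by (simp add: degree_P coeff_eq_0)
        ultimately show ?thesis by (simp only: mult_zero_right diff_self)
      qed
      finally show False
        using phi_P_mult[of r "degree r"] \<open>r \<noteq> 0\<close> sq_norm_pos[of "degree r"] by simp
    qed
    hence eq: "[:0, 1:] * q = Polynomial.smult (coeff ([:0, 1:] * q) n) (P n)" by (simp add: r_def)
    have "coeff ([:0, 1:] * q) n * poly (P n) 0 = 0"
      using arg_cong[OF eq, of "\<lambda>p. poly p 0"] by simp
    thus "poly (P n) 0 = 0" using eq \<open>q \<noteq> 0\<close> by auto
  next
    assume root: "poly (P n) 0 = 0"
    hence n: "n > 0" using P_0 by (cases n) auto
    have "[:0, 1:] dvd P n" using root by (simp add: poly_eq_0_iff_dvd)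
    then obtain q where q: "P n = [:0, 1:] * q" by (elim dvdE)
    have "q \<noteq> 0" using degree_P[of n] n q by auto
    hence deg: "degree q < n" using degree_P[of n] q by (simp add: degree_mult_eq)
    have "\<phi> (monom 1 i * ([:0, 1:] * q)) = 0" if "i < n" for i
      using phi_P_mult[of "monom 1 i" n] that q by (simp add: degree_monom_eq mult.commute)
    hence "A *\<^sub>v Matrix.vec n (coeff q) = 0\<^sub>v n" using Av[OF deg] by blast
    thus "\<exists>v. v \<in> carrier_vec n \<and> v \<noteq> 0\<^sub>v n \<and> A *\<^sub>v v = 0\<^sub>v n"
      using vec_0[OF deg] \<open>q \<noteq> 0\<close> by (intro exI[of _ "Matrix.vec n (coeff q)"]) auto
  qed
  finally show ?thesis .
qed

lemma P_no_consecutive_zeros: "poly (P n) x \<noteq> 0 \<or> poly (P (Suc n)) x \<noteq> 0"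
proof (induction n)
  case (Suc n)
  have "x * poly (P (Suc n)) x =
      poly (P (Suc (Suc n))) x + b (Suc n) * poly (P (Suc n)) x + c n * poly (P n) x"
    using arg_cong[OF recurrence[of "Suc n"], of "\<lambda>p. poly p x"] by simp
  thus ?case using Suc c_pos[of n] by auto
qed (simp add: P_0)

text \<open>
  By \<open>hankel_det_shifted_eq_0_iff\<close> the set enumerated by \<^const>\<open>normal_index\<close> consists of the \<open>m\<close> with
  \<open>P m\<close> nonzero at 0 (including \<open>m = 0\<close>), and it meets every pair of consecutive numbers.
\<close>

lemma normal_index_shifted_props:
  defines "n \<equiv> normal_index (\<lambda>j. moment (Suc j))"
  shows "n 0 = 0" "n j < n (Suc j)" "n (Suc j) \<le> n j + 2"
proof -
  define S where "S = insert 0 (normal_indices (\<lambda>j. moment (Suc j)))"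
  have S_iff: "m \<in> S \<longleftrightarrow> poly (P m) 0 \<noteq> 0" for m
    using hankel_det_shifted_eq_0_iff[of m] P_0
    by (cases "m = 0") (auto simp: S_def normal_indices_def)
  have consec: "m \<in> S \<or> Suc m \<in> S" for m
    using P_no_consecutive_zeros[of m 0] by (simp add: S_iff)
  have inf: "infinite S"
    unfolding infinite_nat_iff_unbounded using consec by (meson lessI less_SucI)
  have n: "n = enumerate S" by (simp add: n_def normal_index_def S_def)
  show "n 0 = 0" unfolding n enumerate_0 by (rule Least_equality) (auto simp: S_def)
  show "n j < n (Suc j)" unfolding n by (rule enumerate_step[OF inf])
  show "n (Suc j) \<le> n j + 2"
  proof -
    have "\<exists>m\<in>S. n j < m \<and> m \<le> n j + 2"
      using consec[of "Suc (n j)"]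
      by (elim disjE) (rule bexI[rotated], assumption, simp)+
    then obtain m where "m \<in> S" "n j < m" "m \<le> n j + 2" by blast
    hence "n (Suc j) \<le> m"
      unfolding n enumerate_Suc''[OF inf] by (intro Least_le) auto
    thus ?thesis using \<open>m \<le> n j + 2\<close> by simp
  qed
qed

end

section \<open>Block matrices and block LU-factorizations\<close>

lemma inf_mat_mult_row:
  assumes "finite S" "\<And>k. k \<notin> S \<Longrightarrow> A r k = 0"
  shows "inf_mat_mult A B r c = (\<Sum>k\<in>S. A r k * B k c)"
  unfolding inf_mat_mult_def using assms by (intro suminf_finite) auto

locale block_partition =
  fixes n :: "nat \<Rightarrow> nat"
  assumes n_0: "n 0 = 0"
    and n_less_Suc: "n j < n (Suc j)"
begin

lemma n_Suc: "n (Suc j) = n j + gap n j"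
  using n_less_Suc[of j] by (simp add: gap_def)

lemma gap_pos: "gap n j > 0"
  using n_less_Suc[of j] by (simp add: gap_def)

lemma strict_mono_n: "strict_mono n"
  using n_less_Suc by (simp add: strict_mono_Suc_iff)

lemma n_eq_iff [simp]: "n i = n j \<longleftrightarrow> i = j"
  using strict_mono_n by (rule strict_mono_eq)

lemma block_of_add:
  assumes "a < gap n j"
  shows "block_of n (n j + a) = j"
  unfolding block_of_def
proof (rule Least_equality)
  show "n j + a < n (Suc j)" using assms by (simp add: n_Suc)
next
  fix i assume "n j + a < n (Suc i)"
  hence "n j < n (Suc i)" by simp
  thus "j \<le> i" using strict_mono_less[OF strict_mono_n] by simp
qed

lemma index_cases:
  obtains j a where "r = n j + a" "a < gap n j"
proof -
  define j where "j = (LEAST i. r < n (Suc i))"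
  have "r < n (Suc r)" using strict_mono_imp_increasing[OF strict_mono_n, of "Suc r"] by simp
  hence *: "r < n (Suc j)" unfolding j_def by (rule LeastI)
  have "n j \<le> r"
  proof (cases j)
    case (Suc i)
    hence "\<not> r < n (Suc i)" using not_less_Least[of i "\<lambda>i. r < n (Suc i)"] by (simp add: j_def)
    thus ?thesis using Suc by simp
  qed (simp add: n_0)
  thus ?thesis using * by (intro that[of j "r - n j"]) (auto simp: n_Suc)
qed

lemma index_eq_iff:
  assumes "a < gap n i" "b < gap n j"
  shows "n i + a = n j + b \<longleftrightarrow> i = j \<and> a = b"
  using block_of_add[OF assms(1)] block_of_add[OF assms(2)] by fastforce

lemma block_tridiagonal_nth:
  assumes "a < gap n i" "b < gap n j"
  shows "block_tridiagonal n diag super sub (n i + a) (n j + b) =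
     (if j = i then diag i $$ (a, b)
      else if j = Suc i then super i $$ (a, b)
      else if i = Suc j then sub j $$ (a, b) else 0)"
  using assms by (simp add: block_tridiagonal_def block_matrix_def block_of_add)

end

locale block_LU_factors = block_partition +
  fixes l u0 u1 :: "nat \<Rightarrow> real"
  assumes gap_cases: "gap n j = 1 \<or> gap n j = 2"
begin

definition L :: inf_mat where
  "L = block_tridiagonal n
              (\<lambda>j. 1\<^sub>m (gap n j))
              (\<lambda>j. 0\<^sub>m (gap n j) (gap n (Suc j)))
              (\<lambda>j. upper_left (gap n (Suc j)) (gap n j) (l (Suc j)))"

definition U :: inf_mat where
  "U = block_tridiagonal n
              (\<lambda>j. if gap n j = 1 then mat_of_rows_list 1 [[u0 j]]
                   else mat_of_rows_list 2 [[0, 1], [u0 j, u1 j]])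
              (\<lambda>j. lower_left (gap n j) (gap n (Suc j)) 1)
              (\<lambda>j. 0\<^sub>m (gap n (Suc j)) (gap n j))"

lemma block_tridiagonal_first_row:
  assumes "b < gap n j"
  shows "block_tridiagonal n diag super sub (n i) (n j + b) =
     (if j = i then diag i $$ (0, b)
      else if j = Suc i then super i $$ (0, b)
      else if i = Suc j then sub j $$ (0, b) else 0)"
  using block_tridiagonal_nth[OF gap_pos assms, of diag super sub i] by simp

lemma block_tridiagonal_second_row:
  assumes "gap n i = 2" "b < gap n j"
  shows "block_tridiagonal n diag super sub (Suc (n i)) (n j + b) =
     (if j = i then diag i $$ (1, b)
      else if j = Suc i then super i $$ (1, b)
      else if i = Suc j then sub j $$ (1, b) else 0)"
  using block_tridiagonal_nth[of 1 i b j diag super sub] assms by simp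

lemma add_eq_n_iff: "b < gap n j \<Longrightarrow> n j + b = n i \<longleftrightarrow> j = i \<and> b = 0"
  using index_eq_iff[OF _ gap_pos, of b j i] by simp

lemma add_eq_Suc_n_iff: "gap n i = 2 \<Longrightarrow> b < gap n j \<Longrightarrow> n j + b = Suc (n i) \<longleftrightarrow> j = i \<and> b = 1"
  using index_eq_iff[of b j 1 i] by simp

lemma Suc_n_neq: "gap n i = 2 \<Longrightarrow> Suc (n i) \<noteq> n j"
  using index_eq_iff[OF _ gap_pos, of 1 i j] by simp

lemma Suc_n_Suc_neq: "Suc (n (Suc j)) \<noteq> n j"
  using n_less_Suc[of j] by simp

text \<open>
  These rules evaluate an entry of a block matrix once its indices are written as a first index of a
  block plus an offset; the offset within a row is 0 or 1, so rows are treated separately by offset.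
\<close>

lemmas row_simps = block_tridiagonal_first_row block_tridiagonal_second_row add_eq_n_iff
  add_eq_Suc_n_iff Suc_n_neq Suc_n_Suc_neq upper_left_def lower_left_def mat_of_rows_list_def gap_pos less_2_cases_iff

lemma L_first_row_0: "L (n 0) x = (if x = n 0 then 1 else 0)"
  using gap_pos[of 0] by (cases x rule: index_cases) (auto simp: L_def row_simps)

lemma L_first_row_Suc:
  "L (n (Suc j)) x = (if x = n (Suc j) then 1 else if x = n j then l (Suc j) else 0)"
  by (cases x rule: index_cases) (auto simp: L_def row_simps)

lemma L_second_row:
  "gap n j = 2 \<Longrightarrow> L (Suc (n j)) x = (if x = Suc (n j) then 1 else 0)"
  by (cases x rule: index_cases) (auto simp: L_def row_simps)

lemma U_row_1:
  "gap n j = 1 \<Longrightarrow> U (n j) x = (if x = n j then u0 j else if x = n (Suc j) then 1 else 0)"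
  by (cases x rule: index_cases) (auto simp: U_def row_simps)

lemma U_first_row_2:
  "gap n j = 2 \<Longrightarrow> U (n j) x = (if x = Suc (n j) then 1 else 0)"
  by (cases x rule: index_cases) (auto simp: U_def row_simps)

lemma U_second_row_2:
  "gap n j = 2 \<Longrightarrow> U (Suc (n j)) x =
     (if x = n j then u0 j else if x = Suc (n j) then u1 j else if x = n (Suc j) then 1 else 0)"
  by (cases x rule: index_cases) (auto simp: U_def row_simps)

lemma LU_first_row_0: "inf_mat_mult L U (n 0) x = U (n 0) x"
  by (subst inf_mat_mult_row[of "{n 0}"]) (auto simp: L_first_row_0)

lemma LU_first_row_Suc:
  "inf_mat_mult L U (n (Suc j)) x = U (n (Suc j)) x + l (Suc j) * U (n j) x"
  by (subst inf_mat_mult_row[of "{n (Suc j), n j}"]) (auto simp: L_first_row_Suc)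

lemma LU_second_row:
  "gap n j = 2 \<Longrightarrow> inf_mat_mult L U (Suc (n j)) x = U (Suc (n j)) x"
  by (subst inf_mat_mult_row[of "{Suc (n j)}"]) (auto simp: L_second_row)

lemma UL_row_1:
  "gap n j = 1 \<Longrightarrow> inf_mat_mult U L (n j) x = u0 j * L (n j) x + L (n (Suc j)) x"
  by (subst inf_mat_mult_row[of "{n j, n (Suc j)}"]) (auto simp: U_row_1)

lemma UL_first_row_2:
  "gap n j = 2 \<Longrightarrow> inf_mat_mult U L (n j) x = L (Suc (n j)) x"
  by (subst inf_mat_mult_row[of "{Suc (n j)}"]) (auto simp: U_first_row_2)

lemma UL_second_row_2:
  assumes "gap n j = 2"
  shows "inf_mat_mult U L (Suc (n j)) x =
    u0 j * L (n j) x + u1 j * L (Suc (n j)) x + L (n (Suc j)) x"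
  by (subst inf_mat_mult_row[of "{n j, Suc (n j), n (Suc j)}"])
     (use assms in \<open>auto simp: U_second_row_2 n_Suc\<close>)

text \<open>
  The only effect of \<open>L\<close> on a diagonal block of \<open>U\<close> is to add \<open>l\<^sub>j\<^sub>+\<^sub>1\<close> to its lower left entry, and
  below the diagonal \<open>l\<^sub>j\<^sub>+\<^sub>1\<close> multiplies the first column of the next block of \<open>U\<close>, whose only nonzero entry
  \<open>u0 (j + 1)\<close> is the lower left one. So the shape of a generalized Jacobi matrix appears by itself.
\<close>

lemma UL_eq_block_tridiagonal:
  assumes p1: "\<And>j. gap n j = 1 \<Longrightarrow> p j = [:- (u0 j + l (Suc j)), 1:]"
    and p2: "\<And>j. gap n j = 2 \<Longrightarrow> p j = [:- (u0 j + l (Suc j)), - u1 j, 1:]"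
  shows "inf_mat_mult U L = block_tridiagonal n
      (\<lambda>j. companion_block (gap n j) (p j))
      (\<lambda>j. lower_left (gap n j) (gap n (Suc j)) 1)
      (\<lambda>j. lower_left (gap n (Suc j)) (gap n j) (u0 (Suc j) * l (Suc j)))"
    (is "_ = ?M")
proof (intro ext)
  fix r x
  obtain j a where r: "r = n j + a" "a < gap n j" by (rule index_cases)
  obtain i b where x: "x = n i + b" "b < gap n i" by (rule index_cases)
  consider "gap n j = 1" "a = 0" | "gap n j = 2" "a = 0" | "gap n j = 2" "a = 1"
    using gap_cases[of j] r(2) by fastforce
  thus "inf_mat_mult U L r x = ?M r x"
  proof cases
    case 1
    thus ?thesis using x r
      by (cases j) (auto simp: UL_row_1 L_first_row_0 L_first_row_Suc p1 companion_block_def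
          row_simps)
  next
    case 2
    thus ?thesis using x r
      by (auto simp: UL_first_row_2 L_second_row p2 companion_block_def row_simps)
  next
    case 3
    thus ?thesis using x r
      by (cases j) (auto simp: UL_second_row_2 L_first_row_0 L_first_row_Suc L_second_row
        p2 companion_block_def row_simps)
  qed
qed

end

locale jacobi_block_LU = block_LU_factors +
  fixes b c :: "nat \<Rightarrow> real"
  assumes jacobi_eq_LU: "monic_jacobi_matrix b c = inf_mat_mult L U"
begin

text \<open>
  The second row of a block of size 2 is not affected by \<open>L\<close>, so it passes from \<open>U\<close> to \<open>J\<close>.
\<close>

lemma jacobi_coeffs_second_row:
  assumes "gap n j = 2"
  shows "b (Suc (n j)) = u1 j" "c (n j) = u0 j"
  using fun_cong[OF fun_cong[OF jacobi_eq_LU], of "Suc (n j)" "Suc (n j)"]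
        fun_cong[OF fun_cong[OF jacobi_eq_LU], of "Suc (n j)" "n j"] assms
  by (simp_all add: monic_jacobi_matrix_def LU_second_row U_second_row_2)

lemma b_first_row_0: "b 0 = (if gap n 0 = 1 then u0 0 else 0)"
proof -
  have "b 0 = U (n 0) (n 0)"
    unfolding LU_first_row_0[symmetric] jacobi_eq_LU[symmetric]
    by (simp add: monic_jacobi_matrix_def n_0)
  thus ?thesis
    using gap_cases[of 0] by (auto simp: U_row_1 U_first_row_2)
qed

lemma b_first_row_Suc:
  "b (n (Suc j)) = (if gap n (Suc j) = 1 then u0 (Suc j) else 0) + (if gap n j =
      1 then l (Suc j) else 0)"
proof -
  have "b (n (Suc j)) = U (n (Suc j)) (n (Suc j)) + l (Suc j) * U (n j) (n (Suc j))"
    using fun_cong[OF fun_cong[OF jacobi_eq_LU], of "n (Suc j)" "n (Suc j)"]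
    by (simp add: monic_jacobi_matrix_def LU_first_row_Suc)
  moreover have "U (n (Suc j)) (n (Suc j)) = (if gap n (Suc j) = 1 then u0 (Suc j) else 0)"
    using gap_cases[of "Suc j"] by (auto simp: U_row_1 U_first_row_2)
  moreover have "U (n j) (n (Suc j)) = (if gap n j = 1 then 1 else 0)"
    using gap_cases[of j] by (auto simp: U_row_1 U_first_row_2 n_Suc[of j])
  ultimately show ?thesis by simp
qed

text \<open>
  The subdiagonal entry of \<open>J\<close> just before a block start is produced by \<open>l\<close> alone: either with the
  pivot \<open>u0 j\<close> of a block of size 1, or with the entry 1 of a block of size 2.
\<close>

lemma c_first_row_Suc:
  assumes "n (Suc j) = Suc m"
  shows "c m = (if gap n j = 1 then l (Suc j) * u0 j else l (Suc j))"
proof -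
  have "c m = U (n (Suc j)) m + l (Suc j) * U (n j) m"
    unfolding LU_first_row_Suc[symmetric] jacobi_eq_LU[symmetric]
    using assms by (simp add: monic_jacobi_matrix_def)
  moreover have "U (n (Suc j)) m = 0"
    using gap_cases[of "Suc j"] assms n_less_Suc[of "Suc j"]
      U_row_1[of "Suc j" m] U_first_row_2[of "Suc j" m] by auto
  moreover have "U (n j) m = (if gap n j = 1 then u0 j else 1)"
    using gap_cases[of j] assms by (auto simp: U_row_1 U_first_row_2 n_Suc[of j])
  ultimately show ?thesis by simp
qed

end

section \<open>The Darboux transform and its continued fraction\<close>

lemma is_monic_gjm_normalizedI:
  fixes G :: "nat \<Rightarrow> complex \<Rightarrow> complex" and s :: "nat \<Rightarrow> nat \<Rightarrow> real"
    and \<epsilon> b :: "nat \<Rightarrow> real" and p :: "nat \<Rightarrow> real poly"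
  assumes n: "normal_index (s 0) = n" and "G 0 = F"
    and "\<And>j. G j meromorphic_on uhp" and "\<And>j. has_expansion (G j) (s j)"
    and "\<And>j. \<epsilon> j = first_coeff (s j)" and "\<And>j. \<bar>\<epsilon> j\<bar> = 1"
    and "\<And>j. gap n j \<in> {1, 2}" and "\<And>j. degree (p j) = gap n j" and "\<And>j. lead_coeff (p j) = 1"
    and "\<And>j e. e > 0 \<Longrightarrow> (\<lambda>z. - 1 / G j z - of_real (\<epsilon> j) * poly (map_poly of_real (p j)) z)
              \<in> o[sector_infinity e](\<lambda>_. 1)"
    and "\<And>j. b j > 0"
    and "\<And>j. eventually (\<lambda>z. - 1 / G j z =
             of_real (\<epsilon> j) * poly (map_poly of_real (p j)) z + of_real ((b j)\<^sup>2) * G (Suc j) z)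
             (cosparse uhp)"
    and "M = block_tridiagonal n
              (\<lambda>j. companion_block (gap n j) (p j))
              (\<lambda>j. lower_left (gap n j) (gap n (Suc j)) 1)
              (\<lambda>j. lower_left (gap n (Suc j)) (gap n j) (\<epsilon> j * \<epsilon> (Suc j) * (b j)\<^sup>2))"
  shows "is_monic_gjm_normalized F M"
  unfolding is_monic_gjm_normalized_def Let_def
proof (rule exI[of _ G], rule exI[of _ s], rule exI[of _ \<epsilon>], rule exI[of _ p], rule exI[of _ b],
    unfold n, intro conjI allI impI)
qed (rule assms | assumption)+

text \<open>
  The situation of the theorem, with the measure replaced by its moment functional.
\<close>

locale darboux = jacobi_block_LU n l u0 u1 b c + monic_orthogonal_polynomials \<phi> P b c
  for n :: "nat \<Rightarrow> nat" and l u0 u1 b c :: "nat \<Rightarrow> real"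
    and \<phi> :: "real poly \<Rightarrow> real" and P :: "nat \<Rightarrow> real poly" +
  fixes F :: "complex \<Rightarrow> complex"
  assumes F_expansion: "has_expansion F moment"
    and F_holomorphic: "F holomorphic_on uhp"
begin

text \<open>
  These are the functions \<open>\<integral> P\<^sub>m(t) / (t - z) d\<sigma>(t)\<close>. They are defined by their recurrence, the
  constant in the second equation accounting for \<open>J Q = z Q + s\<^sub>0 e\<^sub>0\<close>, because only the recurrence and
  the expansion of \<open>F\<close> matter.
\<close>

fun second_kind :: "nat \<Rightarrow> complex \<Rightarrow> complex" where
  "second_kind 0 z = F z"
| "second_kind (Suc 0) z = (z - of_real (b 0)) * F z + of_real (moment 0)"
| "second_kind (Suc (Suc m)) z =
    (z - of_real (b (Suc m))) * second_kind (Suc m) z - of_real (c m) * second_kind m z"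

text \<open>
  Formally \<open>1 / (t - z)\<close> is the sum of the \<open>- t\<^bsup>j\<^esup> / z\<^bsup>j+1\<^esup>\<close>, whence these coefficients.
\<close>

definition second_kind_fps :: "nat \<Rightarrow> real fps" where
  "second_kind_fps m = expansion_fps (\<lambda>j. \<phi> (P m * monom 1 j))"

lemma phi_P_monom_Suc:
  "\<phi> (P m * monom 1 (Suc j)) = \<phi> (P (Suc m) * monom 1 j) + b m * \<phi> (P m * monom 1 j) +
     (if m = 0 then 0 else c (m - 1) * \<phi> (P (m - 1) * monom 1 j))"
proof -
  have "P m * monom 1 (Suc j) = ([:0, 1:] * P m) * monom 1 j"
    by (simp add: monom_Suc algebra_simps)
  thus ?thesis
    unfolding recurrence by (simp add: ring_distribs phi_add phi_smult)
qed

lemma phi_P_monom_0: "\<phi> (P m * monom 1 0) = (if m = 0 then moment 0 else 0)"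
  by (cases m) (simp_all add: phi_P_Suc moment_def P_0 monom_0)

lemma second_kind_fps_nth_0 [simp]: "fps_nth (second_kind_fps m) 0 = 0"
  by (simp add: second_kind_fps_def)

lemma second_kind_fps_1:
  "second_kind_fps (Suc 0) = fps_shift 1 (second_kind_fps 0) - fps_const (b 0) * second_kind_fps 0 +
      fps_const (moment 0)"
proof (rule fps_ext)
  show "fps_nth (second_kind_fps (Suc 0)) i =
    fps_nth (fps_shift 1 (second_kind_fps 0) - fps_const (b 0) * second_kind_fps 0 +
        fps_const (moment 0)) i" for i
    using phi_P_monom_0[of 0]
    by (cases i) (simp_all add: second_kind_fps_def phi_P_monom_Suc[of 0])
qed

text \<open>
  The coefficient of order 0 on the right-hand side is the value of \<open>\<phi>\<close> at \<open>P (m + 1)\<close>, up to sign, and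
  vanishes by orthogonality. This is why the recurrence introduces no polynomial part.
\<close>

lemma second_kind_fps_Suc_Suc:
  "second_kind_fps (Suc (Suc m)) =
      fps_shift 1 (second_kind_fps (Suc m)) - fps_const (b (Suc m)) * second_kind_fps (Suc m) -
          fps_const (c m) * second_kind_fps m"
proof (rule fps_ext)
  show "fps_nth (second_kind_fps (Suc (Suc m))) i =
    fps_nth (fps_shift 1 (second_kind_fps (Suc m)) -
        fps_const (b (Suc m)) * second_kind_fps (Suc m) -
            fps_const (c m) * second_kind_fps m) i" for i
    using phi_P_monom_0[of "Suc m"]
    by (cases i) (simp_all add: second_kind_fps_def phi_P_monom_Suc[of "Suc m"])
qed

lemma second_kind_asymp: "asymp_series (second_kind m) (second_kind_fps m)"
proof -
  have "(\<lambda>j. \<phi> (P 0 * monom 1 j)) = moment"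
    by (simp add: P_0 moment_def fun_eq_iff)
  moreover have "second_kind 0 = F" by (simp add: fun_eq_iff)
  ultimately have base: "asymp_series (second_kind 0) (second_kind_fps 0)"
    using F_expansion by (simp add: second_kind_fps_def has_expansion_iff_asymp_series)
  show ?thesis
  proof (induction m rule: induct_nat_012)
    case 0
    show ?case by (rule base)
  next
    case 1
    have "asymp_series (\<lambda>z. z * second_kind 0 z - of_real (b 0) * second_kind 0 z +
        of_real (moment 0)) (second_kind_fps (Suc 0))"
      unfolding second_kind_fps_1 using base
      by (intro asymp_series_add asymp_series_diff asymp_series_times_id asymp_series_cmult
            asymp_series_const second_kind_fps_nth_0)
    moreover have "(\<lambda>z. z * second_kind 0 z - of_real (b 0) * second_kind 0 z +
        of_real (moment 0)) = second_kind (Suc 0)"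
      by (simp add: fun_eq_iff algebra_simps)
    ultimately show ?case by (simp only: One_nat_def)
  next
    case (ge2 m)
    have "asymp_series (\<lambda>z. z * second_kind (Suc m) z -
        of_real (b (Suc m)) * second_kind (Suc m) z - of_real (c m) * second_kind m z)
            (second_kind_fps (Suc (Suc m)))"
      unfolding second_kind_fps_Suc_Suc using ge2
      by (intro asymp_series_diff asymp_series_times_id asymp_series_cmult second_kind_fps_nth_0)
    moreover have "(\<lambda>z. z * second_kind (Suc m) z - of_real (b (Suc m)) * second_kind (Suc m) z -
        of_real (c m) * second_kind m z) =
        second_kind (Suc (Suc m))"
      by (simp add: fun_eq_iff algebra_simps)
    ultimately show ?case by (simp only: One_nat_def)
  qed
qed

lemma second_kind_fps_nth_below: "i \<le> m \<Longrightarrow> fps_nth (second_kind_fps m) i = 0"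
  by (cases i) (simp_all add: second_kind_fps_def phi_P_mult degree_monom_eq coeff_eq_0)

lemma second_kind_fps_nth_Suc: "fps_nth (second_kind_fps m) (Suc m) = - sq_norm m"
  by (simp add: second_kind_fps_def phi_P_mult degree_monom_eq)

lemma second_kind_holomorphic: "second_kind m holomorphic_on uhp"
proof (induction m rule: induct_nat_012)
  case 0
  thus ?case using F_holomorphic by (simp cong: holomorphic_cong)
next
  case 1
  thus ?case using F_holomorphic by (simp cong: holomorphic_cong) (intro holomorphic_intros)
next
  case (ge2 m)
  thus ?case by (simp cong: holomorphic_cong) (intro holomorphic_intros)
qed

lemma second_kind_recurrence:
  "z * second_kind (Suc m) z = second_kind (Suc (Suc m)) z +
      of_real (b (Suc m)) * second_kind (Suc m) z + of_real (c m) * second_kind m z"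
  by (simp add: algebra_simps)

text \<open>
  For \<open>j > 0\<close> this is the first entry of block \<open>j - 1\<close> of the vector \<open>U Q\<close>. The constant function
  in front lets the three-term relation hold from the start.
\<close>

definition block_head :: "nat \<Rightarrow> complex \<Rightarrow> complex" where
  "block_head j = (case j of 0 \<Rightarrow> (\<lambda>z. 1)
     | Suc i \<Rightarrow> (\<lambda>z. (if gap n i = 1 then of_real (u0 i) * second_kind (n i) z else 0) +
         second_kind (Suc (n i)) z))"

lemma block_head_0 [simp]: "block_head 0 = (\<lambda>z. 1)"
  by (simp add: block_head_def)

lemma block_head_Suc:
  "block_head (Suc j) z = (if gap n j =
      1 then of_real (u0 j) * second_kind (n j) z + second_kind (Suc (n j)) z
     else second_kind (Suc (n j)) z)"
  by (simp add: block_head_def)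

lemma block_head_1: "block_head (Suc 0) z = z * F z + of_real (moment 0)"
  using b_first_row_0 by (simp add: block_head_Suc n_0 algebra_simps)

text \<open>
  For \<open>j > 0\<close> this is the subdiagonal entry of \<open>U L\<close> between blocks \<open>j - 1\<close> and \<open>j\<close>. The value at 0 is
  the inhomogeneous term \<open>s\<^sub>0 U e\<^sub>0\<close> up to sign, read as a coupling to the constant function.
\<close>

definition coupling :: "nat \<Rightarrow> real" where
  "coupling j = (case j of 0 \<Rightarrow> - (moment 0 * u0 0) | Suc i \<Rightarrow> u0 (Suc i) * l (Suc i))"

text \<open>
  This is the first row of block \<open>j + 1\<close> in \<open>L (U Q) = J Q = z Q\<close>.
\<close>

lemma block_head_L_relation:
  "block_head (Suc (Suc j)) z + of_real (l (Suc j)) * block_head (Suc j) z =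
      z * second_kind (n (Suc j)) z"
proof -
  obtain m where m: "n (Suc j) = Suc m" using n_less_Suc[of j] by (cases "n (Suc j)") auto
  have mj: "gap n j = 1 \<Longrightarrow> m = n j" "gap n j = 2 \<Longrightarrow> m = Suc (n j)"
    using m n_Suc[of j] by auto
  show ?thesis
    unfolding m second_kind_recurrence
    using mj b_first_row_Suc[of j] c_first_row_Suc[OF m] m gap_cases[of j] gap_cases[of "Suc j"]
    by (auto simp: block_head_Suc algebra_simps)
qed

text \<open>
  A form of \<open>block_head_L_relation\<close> that also covers the first block. It is used to eliminate
  \<open>second_kind (n j)\<close>, which enters only with the factor \<open>u0 j\<close>.
\<close>

lemma u0_times_second_kind:
  "of_real (u0 j) * (z * second_kind (n j) z) =
      of_real (u0 j) * block_head (Suc j) z + of_real (coupling j) * block_head j z"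
proof (cases j)
  case 0
  thus ?thesis by (simp add: block_head_1 coupling_def n_0 algebra_simps)
next
  case (Suc i)
  show ?thesis unfolding Suc block_head_L_relation[symmetric]
      by (simp add: coupling_def algebra_simps)
qed

definition block_poly :: "nat \<Rightarrow> real poly" where
  "block_poly j = (if gap n j = 1 then [:- (u0 j + l (Suc j)), 1:]
     else [:- (u0 j + l (Suc j)), - u1 j, 1:])"

lemma poly_block_poly:
  "gap n j = 1 \<Longrightarrow> poly (map_poly of_real (block_poly j)) z = z - of_real (u0 j + l (Suc j))"
  "gap n j = 2 \<Longrightarrow> poly (map_poly of_real (block_poly j)) z =
     z * (z - of_real (u1 j)) - (of_real (u0 j + l (Suc j)) :: complex)"
  by (simp_all add: block_poly_def map_poly_pCons algebra_simps)

text \<open>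
  Row block \<open>j\<close> of \<open>(U L) R = z R + s\<^sub>0 U e\<^sub>0\<close>, with the second entry of a block of size 2 eliminated.
\<close>

lemma three_term:
  "poly (map_poly of_real (block_poly j)) z * block_head (Suc j) z =
      block_head (Suc (Suc j)) z + of_real (coupling j) * block_head j z"
  using gap_cases[of j]
proof
  assume g: "gap n j = 1"
  have "block_head (Suc (Suc j)) z =
      z * second_kind (n (Suc j)) z - of_real (l (Suc j)) * block_head (Suc j) z"
    using block_head_L_relation[of j z] by (simp add: algebra_simps)
  also have "z * second_kind (n (Suc j)) z =
      z * block_head (Suc j) z - of_real (u0 j) * (z * second_kind (n j) z)"
    using g by (simp add: block_head_Suc n_Suc algebra_simps)
  finally show ?thesis unfolding u0_times_second_kind using g
      by (simp add: poly_block_poly algebra_simps)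
next
  assume g: "gap n j = 2"
  have "block_head (Suc (Suc j)) z =
      z * second_kind (n (Suc j)) z - of_real (l (Suc j)) * block_head (Suc j) z"
    using block_head_L_relation[of j z] by (simp add: algebra_simps)
  also have "second_kind (n (Suc j)) z =
      (z - of_real (u1 j)) * block_head (Suc j) z - of_real (u0 j) * second_kind (n j) z"
    using g jacobi_coeffs_second_row[OF g] by (simp add: block_head_Suc n_Suc)
  finally have "block_head (Suc (Suc j)) z = z * (z - of_real (u1 j)) * block_head (Suc j) z
      - of_real (u0 j) * (z * second_kind (n j) z) - of_real (l (Suc j)) * block_head (Suc j) z"
    by (simp add: algebra_simps)
  thus ?thesis unfolding u0_times_second_kind using g by (simp add: poly_block_poly algebra_simps)
qed

text \<open>
  Passing over a block multiplies the squared norm by one or two of the numbers \<open>c\<close>, and the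
  factorization expresses their product through the entries of \<open>L\<close> and \<open>U\<close>.
\<close>

lemma sq_norm_n_Suc: "sq_norm (n (Suc j)) = l (Suc j) * u0 j * sq_norm (n j)"
  using gap_cases[of j]
proof
  assume g: "gap n j = 1"
  hence "n (Suc j) = Suc (n j)" by (simp add: n_Suc)
  thus ?thesis using c_first_row_Suc[of j "n j"] g by (simp add: sq_norm_Suc)
next
  assume g: "gap n j = 2"
  hence "n (Suc j) = Suc (Suc (n j))" by (simp add: n_Suc)
  thus ?thesis using c_first_row_Suc[of j "Suc (n j)"] jacobi_coeffs_second_row(2)[OF g] g
    by (simp add: sq_norm_Suc)
qed

lemma u0_l_nonzero: "u0 j \<noteq> 0" "l (Suc j) \<noteq> 0"
  using sq_norm_n_Suc[of j] sq_norm_pos[of "n (Suc j)"] by auto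

lemma moment_0_pos: "moment 0 > 0"
  using phi_1_pos by (simp add: moment_def monom_0 one_pCons)

lemma coupling_nonzero: "coupling j \<noteq> 0"
  using u0_l_nonzero moment_0_pos by (cases j) (auto simp: coupling_def)

definition block_head_fps :: "nat \<Rightarrow> real fps" where
  "block_head_fps j = (case j of 0 \<Rightarrow> 1
     | Suc i \<Rightarrow> (if gap n i = 1 then fps_const (u0 i) * second_kind_fps (n i) +
         second_kind_fps (Suc (n i))
         else second_kind_fps (Suc (n i))))"

lemma block_head_asymp: "asymp_series (block_head j) (block_head_fps j)"
proof (cases j)
  case 0
  thus ?thesis using asymp_series_const[of 1] by (simp add: block_head_fps_def)
next
  case (Suc i)
  have "asymp_series (\<lambda>z. of_real (u0 i) * second_kind (n i) z + second_kind (Suc (n i)) z)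
          (fps_const (u0 i) * second_kind_fps (n i) + second_kind_fps (Suc (n i)))"
    by (intro asymp_series_add asymp_series_cmult second_kind_asymp)
  thus ?thesis using second_kind_asymp[of "Suc (n i)"]
      by (auto simp: Suc block_head_fps_def block_head_def)
qed

lemma block_head_holomorphic: "block_head j holomorphic_on uhp"
proof (cases j)
  case (Suc i)
  have "(\<lambda>z. of_real (u0 i) * second_kind (n i) z + second_kind (Suc (n i)) z) holomorphic_on uhp"
    by (intro holomorphic_intros second_kind_holomorphic)
  thus ?thesis using second_kind_holomorphic[of "Suc (n i)"]
      by (cases "gap n i = 1") (simp_all add: Suc block_head_def)
qed simp

lemma block_head_fps_nth_below: "i < n j \<Longrightarrow> fps_nth (block_head_fps j) i = 0"
  using gap_cases by (cases j) (fastforce simp: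
      block_head_fps_def n_0 n_Suc second_kind_fps_nth_below)+

lemma block_head_fps_nth_0: "fps_nth (block_head_fps 0) (n 0) = 1"
  by (simp add: block_head_fps_def n_0)

text \<open>
  For a block of size 2 the leading coefficient is minus the squared norm of index \<open>n j + 1\<close>, and
  \<open>u0 j\<close> enters through \<open>c (n j) = u0 j\<close>. So both block sizes lead to the same formula.
\<close>

lemma block_head_fps_nth_Suc: "fps_nth (block_head_fps (Suc j)) (n (Suc j)) =
    - (u0 j * sq_norm (n j))"
  using gap_cases[of j]
proof
  assume g: "gap n j = 2"
  thus ?thesis using second_kind_fps_nth_Suc[of "Suc (n j)"] jacobi_coeffs_second_row(2)[OF g]
    by (simp add: block_head_fps_def n_Suc sq_norm_Suc)
qed (simp add: block_head_fps_def n_Suc second_kind_fps_nth_Suc second_kind_fps_nth_below)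

text \<open>
  This is what makes the first coefficients of the functions \<open>tail j\<close> equal to \<open>1\<close> or \<open>- 1\<close>.
\<close>

lemma block_head_fps_lead_Suc:
  "fps_nth (block_head_fps (Suc j)) (n (Suc j)) = coupling j * fps_nth (block_head_fps j) (n j)"
proof (cases j)
  case 0
  have "sq_norm (n 0) = moment 0" by (simp add: sq_norm_0 n_0 moment_def monom_0 one_pCons)
  thus ?thesis using 0 block_head_fps_nth_Suc[of 0] block_head_fps_nth_0 by (simp add: coupling_def)
next
  case (Suc i)
  thus ?thesis using block_head_fps_nth_Suc[of j] block_head_fps_nth_Suc[of i] sq_norm_n_Suc[of i]
      by (simp add: coupling_def)
qed

lemma block_head_fps_lead_nonzero: "fps_nth (block_head_fps j) (n j) \<noteq> 0"
  by (induction j) (simp_all add: block_head_fps_nth_0 block_head_fps_lead_Suc coupling_nonzero)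

lemma block_head_fps_nonzero: "block_head_fps j \<noteq> 0"
  using block_head_fps_lead_nonzero[of j] by auto

lemma subdegree_block_head_fps: "subdegree (block_head_fps j) = n j"
  using block_head_fps_lead_nonzero block_head_fps_nth_below by (intro subdegreeI) auto

text \<open>
  The choice makes \<open>tail 0\<close> a positive multiple of \<open>z F + s\<^sub>0\<close> and the factors in front of
  \<open>tail (j + 1)\<close> in the recursion positive.
\<close>

primrec leading_sign :: "nat \<Rightarrow> real" where
  "leading_sign 0 = - sgn (coupling 0)"
| "leading_sign (Suc j) = leading_sign j * sgn (coupling (Suc j))"

lemma abs_leading_sign: "\<bar>leading_sign j\<bar> = 1"
  by (induction j) (auto simp: abs_mult abs_sgn_eq coupling_nonzero)

lemma leading_sign_mult_self: "leading_sign j * leading_sign j = 1"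
  using abs_leading_sign[of j] by (metis abs_mult_self_eq mult_1)

text \<open>
  These are the functions generated by the continued fraction: the ratio of consecutive solutions of
  the three-term relation, with the factor that normalizes it.
\<close>

definition tail :: "nat \<Rightarrow> complex \<Rightarrow> complex" where
  "tail j z = of_real (- leading_sign j / coupling j) * (block_head (Suc j) z / block_head j z)"

definition tail_fps :: "nat \<Rightarrow> real fps" where
  "tail_fps j = fps_const (- leading_sign j / coupling j) * (block_head_fps (Suc j) div block_head_fps j)"

lemma block_head_fps_dvd: "block_head_fps j dvd block_head_fps (Suc j)"
  using n_less_Suc[of j] by (simp add: fps_dvd_iff block_head_fps_nonzero subdegree_block_head_fps)

lemma tail_asymp: "asymp_series (tail j) (tail_fps j)"
  unfolding tail_def tail_fps_def
  by (intro asymp_series_cmult asymp_series_divide[OF block_head_asymp block_head_asymp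
      block_head_fps_nonzero])
     (simp add: block_head_fps_dvd)

lemma tail_fps_nth_below:
  assumes "i < gap n j"
  shows "fps_nth (tail_fps j) i = 0"
proof -
  have "subdegree (block_head_fps (Suc j) div block_head_fps j) = gap n j"
    by (subst subdegree_div[OF block_head_fps_dvd]) (simp add: subdegree_block_head_fps gap_def)
  hence "fps_nth (block_head_fps (Suc j) div block_head_fps j) i = 0"
    using assms by (intro nth_less_subdegree_zero) simp
  thus ?thesis by (simp add: tail_fps_def)
qed

lemma tail_fps_lead: "fps_nth (tail_fps j) (gap n j) = - leading_sign j"
proof -
  define C where "C = block_head_fps (Suc j) div block_head_fps j"
  have C: "C * block_head_fps j = block_head_fps (Suc j)" unfolding C_def
      using block_head_fps_dvd by simp
  have sub: "subdegree C = gap n j"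
    unfolding C_def by (subst subdegree_div[OF
        block_head_fps_dvd]) (simp add: subdegree_block_head_fps gap_def)
  have "fps_nth (C * block_head_fps j) (subdegree C + subdegree (block_head_fps j)) =
      fps_nth C (subdegree C) * fps_nth (block_head_fps j) (subdegree (block_head_fps j))"
    by (rule nth_subdegree_mult)
  hence "fps_nth C (gap n j) * fps_nth (block_head_fps j) (n j) =
      coupling j * fps_nth (block_head_fps j) (n j)"
    unfolding C sub subdegree_block_head_fps block_head_fps_lead_Suc[symmetric]
        by (simp add: n_Suc add.commute)
  hence "fps_nth C (gap n j) = coupling j" using block_head_fps_lead_nonzero[of j] by simp
  thus ?thesis using coupling_nonzero[of j] by (simp add: tail_fps_def C_def)
qed

definition scale :: "nat \<Rightarrow> real" where
  "scale j = sqrt \<bar>coupling (Suc j)\<bar>"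

text \<open>
  The three-term relation divided by \<open>block_head (j + 1)\<close>, with \<open>\<epsilon>\<^sub>j\<^sup>2 = 1\<close>. It holds pointwise wherever
  the divisions make sense, both near infinity and off a sparse set.
\<close>

lemma tail_recursion:
  assumes "block_head j z \<noteq> 0" "block_head (Suc j) z \<noteq> 0"
  shows "- 1 / tail j z = of_real (leading_sign j) * poly (map_poly of_real (block_poly j)) z +
      of_real ((scale j)\<^sup>2) * tail (Suc j) z"
proof -
  have leading_sign: "complex_of_real (leading_sign j) * of_real (leading_sign j) = 1"
    by (metis leading_sign_mult_self of_real_1 of_real_mult)
  have e0: "complex_of_real (leading_sign j) \<noteq> 0" using abs_leading_sign[of j] by auto
  have "- 1 / tail j z = of_real (coupling j) * block_head j z / (of_real (leading_sign j) * block_head (Suc j) z)"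
    using assms coupling_nonzero[of j] e0 by (simp add: tail_def field_simps)
  also have "\<dots> = of_real (leading_sign j) * (of_real (coupling j) * block_head j z) / block_head (Suc j) z"
    using leading_sign e0 assms by (simp add: field_simps)
  also have "of_real (coupling j) * block_head j z =
      poly (map_poly of_real (block_poly j)) z * block_head (Suc j) z - block_head (Suc (Suc j)) z"
    using three_term[of j z] by simp
  also have "of_real (leading_sign j) * \<dots> / block_head (Suc j) z =
      of_real (leading_sign j) * poly (map_poly of_real (block_poly j)) z -
          of_real (leading_sign j) * (block_head (Suc (Suc j)) z / block_head (Suc j) z)"
    using assms by (simp add: field_simps)
  also have "of_real (leading_sign j) * (block_head (Suc (Suc j)) z / block_head (Suc j) z) =
      - (of_real ((scale j)\<^sup>2) * tail (Suc j) z)"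
  proof -
    have "(scale j)\<^sup>2 * (- leading_sign (Suc j) / coupling (Suc j)) = - leading_sign j"
      using coupling_nonzero[of "Suc j"] by (simp add: scale_def sgn_if abs_if)
    hence "complex_of_real ((scale j)\<^sup>2) * of_real (- leading_sign (Suc j) / coupling (Suc j)) =
        - of_real (leading_sign j)"
      by (metis of_real_minus of_real_mult)
    thus ?thesis unfolding tail_def by (simp only: mult.assoc[symmetric]) simp
  qed
  finally show ?thesis by simp
qed

lemma leading_sign_beta: "leading_sign j * leading_sign (Suc j) * (scale j)\<^sup>2 =
    u0 (Suc j) * l (Suc j)"
proof -
  have "leading_sign j * leading_sign (Suc j) * (scale j)\<^sup>2 =
      (leading_sign j * leading_sign j) * (sgn (coupling (Suc j)) * \<bar>coupling (Suc j)\<bar>)"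
    by (simp add: scale_def)
  also have "\<dots> = coupling (Suc j)" unfolding leading_sign_mult_self by (simp add: sgn_mult_abs)
  finally show ?thesis by (simp add: coupling_def)
qed

lemma tail_meromorphic: "tail j meromorphic_on uhp"
proof -
  have "block_head i meromorphic_on uhp" for i
    using block_head_holomorphic open_uhp analytic_on_open analytic_on_imp_meromorphic_on by blast
  thus ?thesis unfolding tail_def by (intro meromorphic_intros)
qed

lemma tail_remainder_smallo:
  assumes e: "e > 0"
  shows "(\<lambda>z. - 1 / tail j z - of_real (leading_sign j) * poly (map_poly of_real (block_poly j)) z)
      \<in> o[sector_infinity e](\<lambda>_. 1)"
proof (rule smalloI_tendsto)
  have "(tail (Suc j) \<longlongrightarrow> 0) (sector_infinity e)"
    using asymp_series_tendsto[OF tail_asymp e, of "Suc j"]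
        tail_fps_nth_below[OF gap_pos, of "Suc j"] by simp
  hence "((\<lambda>z. of_real ((scale j)\<^sup>2) * tail (Suc j) z) \<longlongrightarrow> 0) (sector_infinity e)"
    by (rule tendsto_mult_right_zero)
  moreover have "eventually (\<lambda>z. of_real ((scale j)\<^sup>2) * tail (Suc j) z =
      (- 1 / tail j z - of_real (leading_sign j) * poly (map_poly of_real (block_poly j)) z) / 1) (sector_infinity e)"
    using asymp_series_eventually_nonzero[OF block_head_asymp block_head_fps_nonzero e, of j]
      asymp_series_eventually_nonzero[OF block_head_asymp block_head_fps_nonzero e, of "Suc j"]
    by eventually_elim (use tail_recursion in simp)
  ultimately show "((\<lambda>z. (- 1 / tail j z -
      of_real (leading_sign j) * poly (map_poly of_real (block_poly j)) z) / 1) \<longlongrightarrow> 0) (sector_infinity e)"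
    by (rule Lim_transform_eventually)
qed auto

lemma tail_recursion_cosparse:
  "eventually (\<lambda>z. - 1 / tail j z =
      of_real (leading_sign j) * poly (map_poly of_real (block_poly j)) z +
     of_real ((scale j)\<^sup>2) * tail (Suc j) z) (cosparse uhp)"
  using eventually_nonzero_cosparse_uhp[OF block_head_holomorphic block_head_asymp
      block_head_fps_nonzero, of j]
    eventually_nonzero_cosparse_uhp[OF block_head_holomorphic block_head_asymp
        block_head_fps_nonzero, of "Suc j"]
  by eventually_elim (rule tail_recursion)

definition tail_coeffs :: "nat \<Rightarrow> nat \<Rightarrow> real" where
  "tail_coeffs j i = - fps_nth (tail_fps j) (Suc i)"

lemma tail_expansion: "has_expansion (tail j) (tail_coeffs j)"
  using tail_asymp[of j] expansion_fps_Abs[OF tail_fps_nth_below[OF gap_pos, of j]]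
  by (simp add: has_expansion_iff_asymp_series tail_coeffs_def[abs_def])

lemma first_coeff_tail: "first_coeff (tail_coeffs j) = leading_sign j"
proof -
  have "tail_coeffs j i = 0" if "i < gap n j - 1" for i
    using that tail_fps_nth_below[of "Suc i" j] by (simp add: tail_coeffs_def)
  moreover have "tail_coeffs j (gap n j - 1) = leading_sign j"
    using tail_fps_lead[of j] gap_pos[of j] by (simp add: tail_coeffs_def)
  ultimately show ?thesis using first_coeff_eqI[of "gap n j -
      1" "tail_coeffs j"] abs_leading_sign[of j] by fastforce
qed

lemma first_coeff_transform: "\<bar>first_coeff (\<lambda>j. moment (Suc j))\<bar> = \<bar>coupling 0\<bar>"
proof -
  have eq: "expansion_fps (\<lambda>j. moment (Suc j)) = block_head_fps (Suc 0)"
  proof (rule asymp_series_unique)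
    show "asymp_series (\<lambda>z. z * F z + of_real (moment 0)) (expansion_fps (\<lambda>j. moment (Suc j)))"
      using has_expansion_times_id[OF F_expansion] by (simp add: has_expansion_iff_asymp_series)
    show "asymp_series (\<lambda>z. z * F z + of_real (moment 0)) (block_head_fps (Suc 0))"
      unfolding block_head_1[symmetric] by (rule block_head_asymp)
  qed
  have *: "moment (Suc j) = - fps_nth (block_head_fps (Suc 0)) (Suc j)" for j
    unfolding eq[symmetric] by simp
  obtain m where m: "n (Suc 0) = Suc m" using n_less_Suc[of 0] by (cases "n (Suc 0)") auto
  have "first_coeff (\<lambda>j. moment (Suc j)) = moment (Suc m)"
    using * block_head_fps_nth_below[of "Suc _" "Suc 0"] block_head_fps_lead_nonzero[of "Suc 0"] m
    by (intro first_coeff_eqI) auto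
  thus ?thesis using *[of m] block_head_fps_lead_Suc[of 0] m block_head_fps_nth_0 by simp
qed

lemma tail_0:
  "tail 0 = (\<lambda>z. (z * F z + of_real (moment 0)) / of_real \<bar>first_coeff (\<lambda>j. moment (Suc j))\<bar>)"
proof
  fix z
  have "- leading_sign 0 / coupling 0 = 1 / \<bar>coupling 0\<bar>" by (simp add: sgn_if)
  thus "tail 0 z = (z * F z + of_real (moment 0)) / of_real \<bar>first_coeff (\<lambda>j. moment (Suc j))\<bar>"
    unfolding first_coeff_transform tail_def block_head_1 by simp
qed

lemma normal_index_tail: "normal_index (tail_coeffs 0) = normal_index (\<lambda>j. moment (Suc j))"
proof -
  let ?a = "\<bar>first_coeff (\<lambda>j. moment (Suc j))\<bar>"
  have "tail_coeffs 0 = (\<lambda>j. moment (Suc j) / ?a)"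
    using tail_expansion[of 0] has_expansion_divide_const[OF
        has_expansion_times_id[OF F_expansion], of ?a]
    unfolding tail_0 by (rule has_expansion_unique)
  thus ?thesis using normal_index_divide_const[of ?a "\<lambda>j. moment (Suc j)"] coupling_nonzero[of 0]
    by (simp add: first_coeff_transform)
qed

lemma degree_block_poly: "degree (block_poly j) =
    gap n j" and lead_coeff_block_poly: "lead_coeff (block_poly j) = 1"
  using gap_cases[of j] by (auto simp: block_poly_def)

lemma is_monic_gjm_normalized_UL:
  assumes "n = normal_index (\<lambda>j. moment (Suc j))"
  shows "is_monic_gjm_normalized
    (\<lambda>z. (z * F z + of_real (moment 0)) / of_real \<bar>first_coeff (\<lambda>j. moment (Suc j))\<bar>) (inf_mat_mult U L)"
proof (rule is_monic_gjm_normalizedI)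
  show "normal_index (tail_coeffs 0) = n" by (simp only: normal_index_tail assms[symmetric])
  show "leading_sign j = first_coeff (tail_coeffs j)" for j by (simp only: first_coeff_tail)
  show "gap n j \<in> {1, 2}" for j using gap_cases[of j] by simp
  show "scale j > 0" for j using coupling_nonzero[of "Suc j"] by (simp add: scale_def)
  show "inf_mat_mult U L = block_tridiagonal n
     (\<lambda>j. companion_block (gap n j) (block_poly j))
     (\<lambda>j. lower_left (gap n j) (gap n (Suc j)) 1)
     (\<lambda>j. lower_left (gap n (Suc j)) (gap n j) (leading_sign j * leading_sign (Suc j) * (scale j)\<^sup>2))"
    unfolding leading_sign_beta by (rule UL_eq_block_tridiagonal) (simp_all add: block_poly_def)
qed (rule tail_0 tail_meromorphic
    tail_expansion abs_leading_sign degree_block_poly lead_coeff_block_poly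
       tail_remainder_smallo tail_recursion_cosparse | assumption)+

end

section \<open>From the measure to its moment functional\<close>

text \<open>
  Only the positivity of \<open>\<sigma>\<close> needs an argument: a zero measure would represent the zero function.
\<close>

lemma represents_imp_monic_orthogonal_polynomials:
  assumes rep: "represents \<sigma> s F" and "z \<in> uhp" "F z \<noteq> 0"
    and P: "monic_orthogonal \<sigma> P" and c: "\<And>j. c j > 0"
    and rec: "\<And>j. [:0, 1:] * P j = P (Suc j) + Polynomial.smult (b j) (P j) +
               (if j = 0 then 0 else Polynomial.smult (c (j - 1)) (P (j - 1)))"
  shows "monic_orthogonal_polynomials (\<lambda>p. LINT t|\<sigma>. poly p t) P b c"
proof
  interpret finite_measure \<sigma> using rep by (simp add: represents_def)
  have int: "integrable \<sigma> (\<lambda>t. poly p t)" for p :: "real poly"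
    using rep unfolding poly_altdef by (auto simp: represents_def)
  show "(LINT t|\<sigma>. poly (p + q) t) = (LINT t|\<sigma>. poly p t) + (LINT t|\<sigma>. poly q t)" for p q
    by (simp add: int)
  show "(LINT t|\<sigma>. poly (Polynomial.smult a p) t) = a * (LINT t|\<sigma>. poly p t)" for a p
    by simp
  show deg: "degree (P j) = j" "lead_coeff (P j) = 1" for j
    using P unfolding monic_orthogonal_def by blast+
  show P_0: "P 0 = 1"
    using deg[of 0] by (metis degree_eq_zeroE lead_coeff_pCons(2) one_pCons)
  show "(LINT t|\<sigma>. poly (P (Suc j)) t) = 0" for j
  proof -
    have "(LINT t|\<sigma>. poly (P (Suc j)) t * poly (P 0) t) = 0"
      using P unfolding monic_orthogonal_def by blast
    thus ?thesis by (simp add: P_0)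
  qed
  show "(LINT t|\<sigma>. poly 1 t) > 0"
  proof (rule ccontr)
    assume "\<not> (LINT t|\<sigma>. poly 1 t) > 0"
    hence "measure \<sigma> (space \<sigma>) = 0"
      using measure_nonneg[of \<sigma> "space \<sigma>"] by (simp add: less_le)
    hence "space \<sigma> \<in> null_sets \<sigma>"
      by (simp add: null_sets_def emeasure_eq_measure)
    hence "AE t in \<sigma>. 1 / (complex_of_real t - z) = 0"
      by (rule AE_I') auto
    hence "(LINT t|\<sigma>. 1 / (complex_of_real t - z)) = 0"
      by (rule integral_eq_zero_AE)
    thus False using rep assms(2,3) by (simp add: represents_def)
  qed
qed (fact rec c)+

lemma nevanlinna_nonzero: "F \<in> nevanlinna \<Longrightarrow> z \<in> uhp \<Longrightarrow> F z \<noteq> 0"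
  by (auto simp: nevanlinna_def uhp_def)

text \<open>
  The function whose membership in \<^const>\<open>N_minf\<close> has to be shown agrees with \<open>F\<close> on the half plane.
\<close>

lemma transform_in_D_minus:
  assumes "F \<in> N_minf" "a \<noteq> 0"
  shows "(\<lambda>z. z * F z + of_real a) \<in> D_minus"
proof -
  have F: "F holomorphic_on uhp" "\<And>z. z \<in> uhp \<Longrightarrow> F z \<in> uhp"
    using assms by (auto simp: N_minf_def nevanlinna_def)
  let ?F = "\<lambda>z. - of_real a / z + (z * F z + of_real a) / z"
  have eq: "F z = ?F z" if "z \<in> uhp" for z
  proof -
    have "z \<noteq> 0" using that by (auto simp: uhp_def)
    thus ?thesis by (simp add: field_simps)
  qed
  obtain s where "has_expansion F s" using assms by (auto simp: N_minf_def)
  hence "has_expansion ?F s"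
    unfolding has_expansion_iff_asymp_series by (rule asymp_series_cong[OF eq, rotated])
  moreover have "?F \<in> nevanlinna"
    using F holomorphic_transform[OF F(1) eq] eq by (auto simp: nevanlinna_def)
  ultimately have "?F \<in> N_minf" by (auto simp: N_minf_def)
  moreover have "(\<lambda>z. z * F z + of_real a) holomorphic_on uhp"
    by (intro holomorphic_intros F)
  hence "(\<lambda>z. z * F z + of_real a) meromorphic_on uhp"
    using open_uhp analytic_on_open analytic_on_imp_meromorphic_on by blast
  ultimately show ?thesis using assms(2) by (auto simp: D_minus_def)
qed

lemma rational_on_uhp_transformD:
  assumes "rational_on_uhp (\<lambda>z. z * F z + of_real a)"
  shows "rational_on_uhp F"
proof -
  obtain p q :: "complex poly" where q: "q \<noteq> 0"
    and pq: "eventually (\<lambda>z. z * F z + of_real a = poly p z / poly q z) (cosparse uhp)"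
    using assms by (auto simp: rational_on_uhp_def)
  have "{z. poly q z = 0} sparse_in uhp" 
    using poly_roots_finite[OF q] finite_imp_sparse by blast
  hence "eventually (\<lambda>z. poly q z \<noteq> 0) (cosparse uhp)"
    by (simp add: eventually_cosparse)
  hence "eventually (\<lambda>z. F z = poly (p -
      Polynomial.smult (of_real a) q) z / poly ([:0, 1:] * q) z) (cosparse uhp)"
    using pq eventually_in_cosparse[OF order.refl open_uhp]
  proof eventually_elim
    case (elim z)
    have "z \<noteq> 0" using elim(3) by (auto simp: uhp_def)
    have "F z = (poly p z / poly q z - of_real a) / z"
      using elim(2) \<open>z \<noteq> 0\<close> by (simp add: eq_divide_eq algebra_simps flip: elim(2))
    thus ?case using elim(1) \<open>z \<noteq> 0\<close> by (simp add: field_simps)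
  qed
  moreover have "[:0, 1:] * q \<noteq> 0" using q by simp
  ultimately show ?thesis unfolding rational_on_uhp_def by blast
qed

theorem theorem3p2:
  fixes F :: "complex \<Rightarrow> complex" and s :: "nat \<Rightarrow> real" and J L U :: inf_mat
  assumes "F \<in> N_minf"
    and "\<not> rational_on_uhp F"
    and "has_expansion F s"
    and "is_monic_jacobi_of F J"
    and "is_block_LU s J L U"
  shows "(\<lambda>z. z * F z + of_real (s 0)) \<in> D_minus \<and>
         is_monic_gjm_of (\<lambda>z. z * F z + of_real (s 0)) (inf_mat_mult U L)"
proof -
  define n where "n = normal_index (\<lambda>j. s (Suc j))"
  obtain s' \<sigma> P b c where J: "has_expansion F s'" "represents \<sigma> s' F" "monic_orthogonal \<sigma> P"
    "\<And>j. c j > 0" "\<And>j. [:0, 1:] * P j = P (Suc j) + Polynomial.smult (b j) (P j) +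
               (if j = 0 then 0 else Polynomial.smult (c (j - 1)) (P (j - 1)))"
    "J = monic_jacobi_matrix b c"
    using assms(4) unfolding is_monic_jacobi_of_def by blast
  have s': "s' = s" using J(1) assms(3) by (rule has_expansion_unique)
  obtain l u0 u1 where LU:
    "L = block_tridiagonal n (\<lambda>j. 1\<^sub>m (gap n j)) (\<lambda>j. 0\<^sub>m (gap n j) (gap n (Suc j)))
              (\<lambda>j. upper_left (gap n (Suc j)) (gap n j) (l (Suc j)))"
    "U = block_tridiagonal n
              (\<lambda>j. if gap n j = 1 then mat_of_rows_list 1 [[u0 j]]
                   else mat_of_rows_list 2 [[0, 1], [u0 j, u1 j]])
              (\<lambda>j. lower_left (gap n j) (gap n (Suc j)) 1)
              (\<lambda>j. 0\<^sub>m (gap n (Suc j)) (gap n j))"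
    "J = inf_mat_mult L U"
    using assms(5) unfolding is_block_LU_def Let_def n_def by blast
  define \<phi> where "\<phi> = (\<lambda>p. LINT t|\<sigma>. poly p t)"
  have nev: "F \<in> nevanlinna" using assms(1) by (simp add: N_minf_def)
  have "\<i> \<in> uhp" by (simp add: uhp_def)
  interpret monic_orthogonal_polynomials \<phi> P b c
    unfolding \<phi>_def
    using J(2) \<open>\<i> \<in> uhp\<close> nevanlinna_nonzero[OF nev \<open>\<i> \<in> uhp\<close>] J(3-5)
    by (rule represents_imp_monic_orthogonal_polynomials)
  have moment: "moment = s"
  proof
    have "poly (monom 1 j) = (\<lambda>t::real. t ^ j)" for j
      by (simp add: fun_eq_iff poly_monom)
    hence "moment j = (LINT t|\<sigma>. t ^ j)" for j
      unfolding moment_def by (simp add: \<phi>_def)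
    thus "moment j = s j" for j using J(2) by (simp add: represents_def s')
  qed
  note n_props = normal_index_shifted_props[unfolded moment n_def[symmetric]]
  interpret block_LU_factors n l u0 u1
  proof
    show "n 0 = 0" "n j < n (Suc j)" for j by (rule n_props)+
    show "gap n j = 1 \<or> gap n j = 2" for j using n_props(2,3)[of j] by (auto simp: gap_def)
  qed
  interpret darboux n l u0 u1 b c \<phi> P F
  proof
    show "monic_jacobi_matrix b c = inf_mat_mult (block_LU_factors.L n l) (block_LU_factors.U n u0 u1)"
      using LU J(6) unfolding L_def U_def by simp
    show "has_expansion F (monic_orthogonal_polynomials.moment \<phi>)"
      using assms(3) moment by simp
    show "F holomorphic_on uhp" using nev by (simp add: nevanlinna_def)
  qed
  have "is_monic_gjm_normalized
    (\<lambda>z. (z * F z + of_real (s 0)) / of_real \<bar>first_coeff (\<lambda>j. s (Suc j))\<bar>) (inf_mat_mult U L)"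
    using is_monic_gjm_normalized_UL unfolding moment n_def[symmetric] LU(1,2)
    unfolding L_def U_def by simp
  moreover have "(\<lambda>z. z * F z + of_real (s 0)) \<in> D_minus"
    using assms(1) moment_0_pos unfolding moment by (intro transform_in_D_minus) auto
  moreover have "\<not> rational_on_uhp (\<lambda>z. z * F z + of_real (s 0))"
    using assms(2) rational_on_uhp_transformD by blast
  moreover have "has_expansion (\<lambda>z. z * F z + of_real (s 0)) (\<lambda>j. s (Suc j))"
    using assms(3) by (rule has_expansion_times_id)
  ultimately show ?thesis unfolding is_monic_gjm_of_def by blast
qed

end
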